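(* For every $\varepsilon>0$ there exists $C>0$ such that the following holds. If $p=p(n)\geq Cn^{-1/2}$ and $G\sim\mathbb{G}(n,p)$, then with high probability $G$ is $(K_3,\varepsilon n)$-rich.
   Context: $\mathbb{G}(n,p)$ is the binomial random graph on $n$ vertices with edge probability $p$; "with high probability" means with probability tending to $1$ as $n\to\infty$. For $s>0$, a graph $G$ is $(K_3,s)$-rich if for every $2$-colouring (red/blue) of the edges of $G$ and every pair of disjoint sets $X,Y\subset V(G)$ with $|X|=|Y|=s$, at least one of the following holds: (i) there is a red triangle $T$ in $G[X\cup Y]$ with $|V(T)\cap X|\ge 1$; (ii) there is a blue triangle $T$ in $G[X\cup Y]$ with $|V(T)\cap Y|\ge 1$. (A red/blue triangle is one all of whose edges are red/blue.) *)

theory Defs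
  imports "HOL-Probability.Probability" "HOL-Library.Ramsey"
begin

text \<open>
  A finite simple graph is a vertex set \<open>V\<close> together with an edge set
  \<open>E \<subseteq> [V]\<^bsup>2\<^esup>\<close>. A colouring is a total function on vertex sets; only its values on
  the edges of the graph matter.
\<close>

datatype colour = Red | Blue

definition mono_triangle ::
    "'a set set \<Rightarrow> ('a set \<Rightarrow> colour) \<Rightarrow> colour \<Rightarrow> 'a set \<Rightarrow> bool" where
  "mono_triangle E c k T \<longleftrightarrow> card T = 3 \<and> (\<forall>e\<in>[T]\<^bsup>2\<^esup>. e \<in> E \<and> c e = k)"

text \<open>
  The size \<open>s\<close> is a natural number; a real size such as \<open>\<epsilon>n\<close> is rounded down where the notion
  is used. Richness for \<open>s\<close> implies richness for every larger size (pass to subsets of \<open>X\<close>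
  and \<open>Y\<close>), so rounding down is the strongest choice.
\<close>

definition K3_rich :: "'a set \<Rightarrow> 'a set set \<Rightarrow> nat \<Rightarrow> bool" where
  "K3_rich V E s \<longleftrightarrow>
     (\<forall>(c :: 'a set \<Rightarrow> colour) X Y.
        X \<subseteq> V \<and> Y \<subseteq> V \<and> X \<inter> Y = {} \<and> card X = s \<and> card Y = s \<longrightarrow>
        (\<exists>T. T \<subseteq> X \<union> Y \<and> mono_triangle E c Red T \<and> card (T \<inter> X) \<ge> 1) \<or>
        (\<exists>T. T \<subseteq> X \<union> Y \<and> mono_triangle E c Blue T \<and> card (T \<inter> Y) \<ge> 1))"

text \<open>The edge set of the binomial random graph on the vertex set \<open>{..<n}\<close>.\<close>

definition gnp :: "nat \<Rightarrow> real \<Rightarrow> nat set set pmf" where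
  "gnp n p =
     map_pmf (\<lambda>f. {e \<in> [{..<n}]\<^bsup>2\<^esup>. f e})
       (Pi_pmf ([{..<n}]\<^bsup>2\<^esup>) False (\<lambda>_. bernoulli_pmf p))"

end

theory Submission
  imports Defs
begin

text \<open>
  By the hypergraph container method: the edge sets of triangles form a 3-uniform hypergraph on the
  pairs of vertices in which two triangles share at most one pair, so a set of pairs without such a
  triangle lies in a container with few triangles that is determined by a fingerprint of
  \<open>O(n powr (3/2))\<close> of its elements.
  In a bad colouring the red edges inside \<open>X \<union> Y\<close> contain no triangle touching \<open>X\<close> and the blue edges
  contain none touching \<open>Y\<close>; both lie in containers that are nearly free of such triangles. A pair of
  such containers misses a constant proportion of the pairs in \<open>X \<union> Y\<close>, and the random graph has no
  edge there outside the fingerprints. This has probability at most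
  \<open>p ^ \<bar>T\<bar> * exp (- p * \<gamma> * n\<^sup>2 / 2)\<close> for a pair of fingerprints with union \<open>T\<close>, which beats the union
  bound over \<open>X\<close>, \<open>Y\<close> and all fingerprints once \<open>p * n\<^sup>2\<close> is a large multiple of \<open>n powr (3/2)\<close>.
\<close>

section \<open>Containers for linear triple systems\<close>

text \<open>The intended instance has the pairs of graph vertices as points and the edge sets of
  triangles as triples; \<open>H_linear\<close> then expresses that two edges determine their
  triangle.\<close>

locale linear_triples =
  fixes V :: "'a set" and H :: "'a set set"
  assumes finite_V: "finite V"
    and H_sub: "t \<in> H \<Longrightarrow> t \<subseteq> V"
    and H_card: "t \<in> H \<Longrightarrow> card t = 3"
    and H_linear: "\<lbrakk>t \<in> H; t' \<in> H; e \<subseteq> t; e \<subseteq> t'; card e = 2\<rbrakk> \<Longrightarrow> t = t'"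
begin

lemma finite_H: "finite H"
  by (rule finite_subset[of _ "Pow V"]) (use H_sub finite_V in auto)

section \<open>Decision trees with containers at their leaves\<close>

text \<open>\<open>A\<close> holds the points still available, \<open>G\<close> the sets already
  known not to lie inside \<open>I\<close>, and \<open>k\<close> the budget for further fingerprint
  points. The single \<open>g\<close> is fixed before \<open>I\<close>, so counting containers
  reduces to counting fingerprints.\<close>

definition container :: "real \<Rightarrow> 'a set set \<Rightarrow> 'a set \<Rightarrow> real \<Rightarrow> bool" where
  "container m G A k \<longleftrightarrow> (\<exists>g. \<forall>I\<subseteq>A. (\<forall>t\<in>H. \<not> t \<subseteq> I) \<longrightarrow> (\<forall>e\<in>G. \<not> e \<subseteq> I) \<longrightarrow>
     (\<exists>T\<subseteq>I. real (card T) \<le> k \<and> I \<subseteq> T \<union> g T \<and> real (card {t\<in>H. t \<subseteq> g T}) \<le> m))"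

lemma container_leaf:
  assumes "real (card {t\<in>H. t \<subseteq> A}) \<le> m" "0 \<le> k"
  shows "container m G A k"
  unfolding container_def using assms
  by (intro exI[of _ "\<lambda>_. A"] allI impI exI[of _ "{}"]) auto

lemma container_mono:
  assumes "container m G A k" "G \<subseteq> G'" "k \<le> k'"
  shows "container m G' A k'"
proof -
  obtain g where g: "\<And>I. I \<subseteq> A \<Longrightarrow> \<forall>t\<in>H. \<not> t \<subseteq> I \<Longrightarrow> \<forall>e\<in>G. \<not> e \<subseteq> I \<Longrightarrow>
     \<exists>T\<subseteq>I. real (card T) \<le> k \<and> I \<subseteq> T \<union> g T \<and> real (card {t\<in>H. t \<subseteq> g T}) \<le> m"
    using assms(1) unfolding container_def by blast
  show ?thesis unfolding container_def
  proof (intro exI[of _ g] allI impI)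
    fix I assume "I \<subseteq> A" "\<forall>t\<in>H. \<not> t \<subseteq> I" "\<forall>e\<in>G'. \<not> e \<subseteq> I"
    with g[of I] assms(2) have "\<exists>T\<subseteq>I. real (card T) \<le> k \<and> I \<subseteq> T \<union> g T \<and> real (card {t\<in>H. t \<subseteq> g T}) \<le> m"
      by blast
    with assms(3) show "\<exists>T\<subseteq>I. real (card T) \<le> k' \<and> I \<subseteq> T \<union> g T \<and> real (card {t\<in>H. t \<subseteq> g T}) \<le> m"
      by (meson order_trans)
  qed
qed

text \<open>One query of a decision tree: the fingerprint consists of the queried vertices that lie in
  \<open>I\<close>, so the branch taken at \<open>v\<close> can be read off the fingerprint.\<close>

lemma container_branch:
  assumes "finite A"
    and no: "container m G (A - {v}) k"
    and yes: "container m G' A' (k - 1)"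
    and red: "\<And>I. \<lbrakk>I \<subseteq> A; v \<in> I; \<forall>t\<in>H. \<not> t \<subseteq> I; \<forall>e\<in>G. \<not> e \<subseteq> I\<rbrakk> \<Longrightarrow>
                 I - {v} \<subseteq> A' \<and> (\<forall>e\<in>G'. \<not> e \<subseteq> I - {v})"
  shows "container m G A k"
proof -
  obtain g where g: "\<And>I. I \<subseteq> A - {v} \<Longrightarrow> \<forall>t\<in>H. \<not> t \<subseteq> I \<Longrightarrow> \<forall>e\<in>G. \<not> e \<subseteq> I \<Longrightarrow>
     \<exists>T\<subseteq>I. real (card T) \<le> k \<and> I \<subseteq> T \<union> g T \<and> real (card {t\<in>H. t \<subseteq> g T}) \<le> m"
    using no unfolding container_def by blast
  obtain g' where g': "\<And>I. I \<subseteq> A' \<Longrightarrow> \<forall>t\<in>H. \<not> t \<subseteq> I \<Longrightarrow> \<forall>e\<in>G'. \<not> e \<subseteq> I \<Longrightarrow>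
     \<exists>T\<subseteq>I. real (card T) \<le> k - 1 \<and> I \<subseteq> T \<union> g' T \<and> real (card {t\<in>H. t \<subseteq> g' T}) \<le> m"
    using yes unfolding container_def by blast
  define h where "h T = (if v \<in> T then g' (T - {v}) else g T)" for T
  show ?thesis unfolding container_def
  proof (intro exI[of _ h] allI impI)
    fix I assume I: "I \<subseteq> A" "\<forall>t\<in>H. \<not> t \<subseteq> I" "\<forall>e\<in>G. \<not> e \<subseteq> I"
    show "\<exists>T\<subseteq>I. real (card T) \<le> k \<and> I \<subseteq> T \<union> h T \<and> real (card {t\<in>H. t \<subseteq> h T}) \<le> m"
    proof (cases "v \<in> I")
      case True
      have "I - {v} \<subseteq> A'" "\<forall>e\<in>G'. \<not> e \<subseteq> I - {v}" "\<forall>t\<in>H. \<not> t \<subseteq> I - {v}"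
        using red[OF I(1) True I(2,3)] I(2) by auto
      from g'[OF this(1,3,2)] obtain T where T: "T \<subseteq> I - {v}" "real (card T) \<le> k - 1"
        "I - {v} \<subseteq> T \<union> g' T" "real (card {t\<in>H. t \<subseteq> g' T}) \<le> m" by blast
      have vT: "v \<notin> T" "finite T" using T(1) I(1) assms(1) by (auto dest: finite_subset)
      have "h (insert v T) = g' T" using vT by (simp add: h_def)
      moreover have "real (card (insert v T)) \<le> k" using T(2) vT by simp
      moreover have "insert v T \<subseteq> I" "I \<subseteq> insert v T \<union> g' T" using T(1,3) True by auto
      ultimately show ?thesis using T(4) by (intro exI[of _ "insert v T"]) simp
    next
      case False
      then have "I \<subseteq> A - {v}" using I(1) by auto
      from g[OF this I(2,3)] obtain T where T: "T \<subseteq> I" "real (card T) \<le> k"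
        "I \<subseteq> T \<union> g T" "real (card {t\<in>H. t \<subseteq> g T}) \<le> m" by blast
      with False have "h T = g T" by (auto simp: h_def)
      with T show ?thesis by (intro exI[of _ T]) simp
    qed
  qed
qed

text \<open>In this and the following lemmas \<open>leaf\<close> is the continuation of the decision tree at the end of
  the phase, which lets the phases be composed without decoding a union of fingerprints.\<close>

lemma container_graph_phase:
  assumes "A \<subseteq> V" "0 < r"
    and G: "\<And>e. e \<in> G \<Longrightarrow> card e = 2"
    and leaf: "\<And>A'. \<lbrakk>A' \<subseteq> A; \<forall>a\<in>A'. real (card {e\<in>G. a \<in> e \<and> e \<subseteq> A'}) < r\<rbrakk> \<Longrightarrow> container m G A' k"
  shows "container m G A (k + card A / r)"
  using assms(1) leaf
proof (induction "card A" arbitrary: A rule: less_induct)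
  case less
  have finA: "finite A" using less.prems(1) finite_V finite_subset by blast
  show ?case
  proof (cases "\<forall>a\<in>A. real (card {e\<in>G. a \<in> e \<and> e \<subseteq> A}) < r")
    case True
    show ?thesis
      by (rule container_mono[OF less.prems(2)[OF order_refl True]]) (use assms(2) in auto)
  next
    case False
    then obtain v where v: "v \<in> A" "r \<le> real (card {e\<in>G. v \<in> e \<and> e \<subseteq> A})" by (auto simp: not_less)
    define N where "N = {u\<in>A. {v,u} \<in> G}"
    have sub: "{e\<in>G. v \<in> e \<and> e \<subseteq> A} \<subseteq> (\<lambda>u. {v,u}) ` N"
    proof
      fix e assume e: "e \<in> {e\<in>G. v \<in> e \<and> e \<subseteq> A}"
      then obtain x y where "e = {x,y}" "x \<noteq> y" using G[of e] by (auto simp: card_2_iff)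
      then obtain u where "e = {v,u}" using e by (auto simp: insert_commute)
      then show "e \<in> (\<lambda>u. {v,u}) ` N" using e by (auto simp: N_def)
    qed
    have finN: "finite N" unfolding N_def using finA by auto
    have "card {e\<in>G. v \<in> e \<and> e \<subseteq> A} \<le> card N"
      using surj_card_le[OF finN sub] .
    then have rN: "r \<le> real (card N)" using v(2) by linarith
    have "v \<notin> N" using G[of "{v}"] by (auto simp: N_def)
    \<comment> \<open>If \<open>v\<close> lies in \<open>I\<close>, none of its neighbours does, so
      the yes-branch loses more than \<open>r\<close> points and pays for \<open>v\<close> out of
      \<open>card A / r\<close>; the no-branch loses only \<open>v\<close> and pays nothing.\<close>
    define A' where "A' = A - insert v N"
    have "card A' = card A - card (insert v N)"
      unfolding A'_def by (rule card_Diff_subset) (use v(1) finN in \<open>auto simp: N_def\<close>)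
    moreover have "card (insert v N) \<le> card A"
      by (rule card_mono[OF finA]) (use v(1) in \<open>auto simp: N_def\<close>)
    ultimately have cA': "real (card A') \<le> real (card A) - r" "card A' < card A"
      using rN \<open>v \<notin> N\<close> finN by auto
    show ?thesis
    proof (rule container_branch[OF finA, where v = v and G' = G and A' = A'])
      have "card (A - {v}) < card A" using v(1) finA by (meson card_Diff1_less)
      then have "container m G (A - {v}) (k + card (A - {v}) / r)"
        using less.prems by (intro less.hyps) auto
      then show "container m G (A - {v}) (k + card A / r)"
        by (rule container_mono) (use assms(2) finA in \<open>auto intro!: divide_right_mono card_mono\<close>)
      have "container m G A' (k + card A' / r)"
        using less.prems cA' by (intro less.hyps) (auto simp: A'_def)
      then show "container m G A' (k + card A / r - 1)"
      proof (rule container_mono)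
        have "card A' / r \<le> (card A - r) / r"
          using assms(2) cA'(1) by (intro divide_right_mono) auto
        also have "\<dots> = card A / r - 1" using assms(2) by (simp add: diff_divide_distrib)
        finally show "k + card A' / r \<le> k + card A / r - 1" by simp
      qed auto
    next
      fix I assume "I \<subseteq> A" "v \<in> I" "\<forall>e\<in>G. \<not> e \<subseteq> I"
      then show "I - {v} \<subseteq> A' \<and> (\<forall>e\<in>G. \<not> e \<subseteq> I - {v})"
        by (auto simp: A'_def N_def)
    qed
  qed
qed

section \<open>Links of fingerprint points\<close>

definition gdeg :: "'a set set \<Rightarrow> 'a \<Rightarrow> nat" where
  "gdeg G a = card {e\<in>G. a \<in> e}"

lemma sum_gdeg:
  assumes "finite B" "\<And>e. e \<in> G \<Longrightarrow> card e = 2 \<and> e \<subseteq> B"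
  shows "(\<Sum>a\<in>B. gdeg G a) = 2 * card G"
proof -
  have fG: "finite G" by (rule finite_subset[of _ "Pow B"]) (use assms in auto)
  have "(\<Sum>a\<in>B. gdeg G a) = (\<Sum>a\<in>B. \<Sum>e\<in>G. if a \<in> e then 1 else 0)"
    unfolding gdeg_def using fG by (simp flip: sum.inter_filter)
  also have "\<dots> = (\<Sum>e\<in>G. \<Sum>a\<in>B. if a \<in> e then 1 else 0)" by (rule sum.swap)
  also have "\<dots> = (\<Sum>e\<in>G. 2)"
  proof (rule sum.cong[OF refl])
    fix e assume "e \<in> G"
    then have "{a\<in>B. a \<in> e} = e" "card e = 2" using assms(2) by auto
    then show "(\<Sum>a\<in>B. if a \<in> e then 1 else 0) = (2::nat)"
      using assms(1) by (simp flip: sum.inter_filter)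
  qed
  finally show ?thesis by simp
qed

text \<open>The graph \<open>G\<close> collects links of fingerprint vertices, which have all left \<open>A\<close>; by linearity
  links of later vertices are new, and each is a matching.\<close>

definition link_graph :: "nat \<Rightarrow> 'a set \<Rightarrow> 'a set set \<Rightarrow> 'a set \<Rightarrow> bool" where
  "link_graph D A0 G A \<longleftrightarrow> A \<subseteq> A0 \<and> (\<forall>e\<in>G. card e = 2 \<and> e \<subseteq> A0 \<and> (\<exists>v. v \<notin> A \<and> insert v e \<in> H)) \<and>
     (\<forall>a. gdeg G a \<le> D)"

text \<open>Only triples without a saturated point supply links. Distinct triples through
  \<open>v\<close> share no further point, so every degree grows by at most one, and only where it
  was below \<open>D\<close>.\<close>

lemma link_graph_extend:
  assumes inv: "link_graph D A0 G A" and A0: "A0 \<subseteq> V" and v: "v \<in> A"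
  defines "H' \<equiv> {t\<in>H. t \<subseteq> A \<and> (\<forall>a\<in>t. gdeg G a < D)}"
  defines "L \<equiv> (\<lambda>t. t - {v}) ` {t\<in>H'. v \<in> t}"
  shows "link_graph D A0 (G \<union> L) (A - {v})"
    and "card (G \<union> L) = card G + card {t\<in>H'. v \<in> t}"
proof -
  have finA0: "finite A0" using A0 finite_V finite_subset by blast
  have fG: "finite G"
    by (rule finite_subset[of _ "Pow A0"]) (use inv finA0 in \<open>auto simp: link_graph_def\<close>)
  have fH': "finite H'" unfolding H'_def using finite_H by auto
  have fL: "finite L" unfolding L_def using fH' by auto
  have ins: "insert v e \<in> H'" "card e = 2" "v \<notin> e" if "e \<in> L" for e
  proof -
    from that obtain t where t: "t \<in> H'" "v \<in> t" "e = t - {v}" by (auto simp: L_def)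
    then have "card t = 3" using H_card by (auto simp: H'_def)
    then show "insert v e \<in> H'" "card e = 2" "v \<notin> e" using t
      by (auto simp: insert_absorb)
  qed
  have deg: "gdeg (G \<union> L) a \<le> D" for a
  proof (cases "\<exists>e\<in>L. a \<in> e")
    case True
    then obtain e where e: "e \<in> L" "a \<in> e" by auto
    \<comment> \<open>Two links through \<open>a\<close> would give two triples sharing the pair
      \<open>{a,v}\<close>.\<close>
    have "e' = e" if "e' \<in> L" "a \<in> e'" for e'
    proof -
      have "a \<noteq> v" using ins(3)[OF e(1)] e(2) by auto
      then have "insert v e = insert v e'"
        using ins(1)[OF e(1)] ins(1)[OF that(1)] e that
        by (intro H_linear[where e = "{a,v}"]) (auto simp: H'_def)
      then show ?thesis using ins(3)[OF e(1)] ins(3)[OF that(1)] by (simp add: insert_ident)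
    qed
    then have "{e\<in>G \<union> L. a \<in> e} \<subseteq> insert e {e\<in>G. a \<in> e}" by auto
    then have "gdeg (G \<union> L) a \<le> card (insert e {e\<in>G. a \<in> e})"
      unfolding gdeg_def using fG by (intro card_mono) auto
    also have "\<dots> \<le> Suc (gdeg G a)" unfolding gdeg_def using fG by (simp add: card_insert_if)
    also have "\<dots> \<le> D" using ins(1)[OF e(1)] e(2) by (force simp: H'_def)
    finally show ?thesis .
  next
    case False
    then have "{e\<in>G \<union> L. a \<in> e} = {e\<in>G. a \<in> e}" by auto
    then show ?thesis using inv by (auto simp: gdeg_def link_graph_def)
  qed
  show "link_graph D A0 (G \<union> L) (A - {v})"
    unfolding link_graph_def
  proof (intro conjI ballI allI deg)
    show "A - {v} \<subseteq> A0" using inv by (auto simp: link_graph_def)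
    fix e assume "e \<in> G \<union> L"
    then show "card e = 2" "e \<subseteq> A0" "\<exists>w. w \<notin> A - {v} \<and> insert w e \<in> H"
      using inv ins[of e] by (auto simp: link_graph_def H'_def)
  qed
  have "G \<inter> L = {}"
  proof (rule ccontr)
    assume "G \<inter> L \<noteq> {}"
    then obtain e where e: "e \<in> G" "e \<in> L" by auto
    then obtain w where w: "w \<notin> A" "insert w e \<in> H" using inv by (auto simp: link_graph_def)
    \<comment> \<open>Linearity makes both extensions of \<open>e\<close> the same triple, but
      \<open>w\<close> is outside \<open>A\<close> while the triple of the new link lies in
      \<open>A\<close>.\<close>
    have "insert w e = insert v e"
      using ins[OF e(2)] w by (intro H_linear[where e = e]) (auto simp: H'_def)
    moreover have "insert v e \<subseteq> A" using ins(1)[OF e(2)] by (auto simp: H'_def)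
    ultimately show False using w by auto
  qed
  then have "card (G \<union> L) = card G + card L" using fG fL by (simp add: card_Un_disjoint)
  moreover have "card L = card {t\<in>H'. v \<in> t}"
    unfolding L_def by (rule card_image) (auto simp: inj_on_def)
  ultimately show "card (G \<union> L) = card G + card {t\<in>H'. v \<in> t}" by simp
qed

section \<open>The two phases of a round and their iteration\<close>

text \<open>Many saturated points mean many pairs in \<open>G\<close>. Once the graph phase has made
  \<open>G\<close> sparse inside \<open>A'\<close>, at least \<open>\<delta> / 8 * N * D\<close>
  pairs must meet \<open>A0 - A'\<close>; each point there meets at most \<open>D\<close> of them,
  so at least \<open>\<delta> / 8 * N\<close> points are gone.\<close>

lemma container_saturated:
  assumes inv: "link_graph D A0 G A" and A0: "A0 \<subseteq> V" and N: "real (card V) \<le> N"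
    and D: "0 < D" and \<delta>: "0 < \<delta>"
    and sat: "\<delta> / 2 * N \<le> card {a\<in>V. D \<le> gdeg G a}"
    and leaf: "\<And>A'. \<lbrakk>A' \<subseteq> A0; \<delta> / 8 * N \<le> card (A0 - A')\<rbrakk> \<Longrightarrow> container m {} A' k"
  shows "container m G A (k + 8 * N / (\<delta> * D))"
proof -
  have finA0: "finite A0" using A0 finite_V finite_subset by blast
  have G: "card e = 2" "e \<subseteq> A0" if "e \<in> G" for e using inv that by (auto simp: link_graph_def)
  have fG: "finite G" by (rule finite_subset[of _ "Pow A0"]) (use G finA0 in auto)
  have AV: "A \<subseteq> V" using inv A0 by (auto simp: link_graph_def)
  \<comment> \<open>With this threshold the pairs left inside \<open>A'\<close> number at most
    \<open>N * r\<close>, half of the lower bound for \<open>card G\<close>.\<close>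
  define r where "r = \<delta> * D / 8"
  have r: "0 < r" using D \<delta> by (simp add: r_def)
  have eG: "\<delta> / 4 * N * D \<le> card G"
  proof -
    have "card {a\<in>V. D \<le> gdeg G a} * D = (\<Sum>a | a \<in> V \<and> D \<le> gdeg G a. D)" by simp
    also have "\<dots> \<le> (\<Sum>a | a \<in> V \<and> D \<le> gdeg G a. gdeg G a)" by (rule sum_mono) auto
    also have "\<dots> \<le> (\<Sum>a\<in>V. gdeg G a)" by (rule sum_mono2) (use finite_V in auto)
    also have "\<dots> = 2 * card G" by (rule sum_gdeg) (use finite_V G A0 in auto)
    finally have "real (card {a\<in>V. D \<le> gdeg G a}) * D \<le> 2 * real (card G)"
      by (metis of_nat_le_iff of_nat_mult of_nat_numeral)
    moreover have "\<delta> / 2 * N * D \<le> real (card {a\<in>V. D \<le> gdeg G a}) * D"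
      by (rule mult_right_mono[OF sat]) simp
    ultimately show ?thesis by simp
  qed
  have "container m G A (k + card A / r)"
  proof (rule container_graph_phase[OF AV r G(1)])
    fix A' assume A': "A' \<subseteq> A" "\<forall>a\<in>A'. real (card {e\<in>G. a \<in> e \<and> e \<subseteq> A'}) < r"
    have A'A0: "A' \<subseteq> A0" using A' inv by (auto simp: link_graph_def)
    have finA': "finite A'" using A'A0 finA0 finite_subset by blast
    have sub: "G \<subseteq> (\<Union>a\<in>A'. {e\<in>G. a \<in> e \<and> e \<subseteq> A'}) \<union> (\<Union>a\<in>A0-A'. {e\<in>G. a \<in> e})"
    proof
      fix e assume e: "e \<in> G"
      then have "e \<noteq> {}" using G(1) by fastforce
      then show "e \<in> (\<Union>a\<in>A'. {e\<in>G. a \<in> e \<and> e \<subseteq> A'}) \<union> (\<Union>a\<in>A0-A'. {e\<in>G. a \<in> e})"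
        using e G(2)[OF e] by (cases "e \<subseteq> A'") auto
    qed
    have "card G \<le> card ((\<Union>a\<in>A'. {e\<in>G. a \<in> e \<and> e \<subseteq> A'}) \<union> (\<Union>a\<in>A0-A'. {e\<in>G. a \<in> e}))"
      by (rule card_mono[OF _ sub]) (use finA' finA0 fG in auto)
    also have "\<dots> \<le> card (\<Union>a\<in>A'. {e\<in>G. a \<in> e \<and> e \<subseteq> A'}) + card (\<Union>a\<in>A0-A'. {e\<in>G. a \<in> e})"
      by (rule card_Un_le)
    also have "\<dots> \<le> (\<Sum>a\<in>A'. card {e\<in>G. a \<in> e \<and> e \<subseteq> A'}) + (\<Sum>a\<in>A0-A'. card {e\<in>G. a \<in> e})"
      by (intro add_mono card_UN_le) (use finA' finA0 in auto)
    finally have "real (card G) \<le> (\<Sum>a\<in>A'. real (card {e\<in>G. a \<in> e \<and> e \<subseteq> A'})) + (\<Sum>a\<in>A0-A'. real (card {e\<in>G. a \<in> e}))"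
      by (simp flip: of_nat_sum of_nat_add)
    also have "\<dots> \<le> (\<Sum>a\<in>A'. r) + (\<Sum>a\<in>A0-A'. real D)"
      by (intro add_mono sum_mono)
        (use A'(2) inv in \<open>auto simp: link_graph_def gdeg_def intro: less_imp_le\<close>)
    also have "\<dots> = card A' * r + card (A0 - A') * real D" by simp
    also have "card A' * r \<le> N * r"
    proof (rule mult_right_mono)
      have "card A' \<le> card V" by (rule card_mono[OF finite_V]) (use A'A0 A0 in auto)
      then show "real (card A') \<le> N" using N by linarith
    qed (use r in simp)
    finally have "\<delta> / 4 * N * D \<le> N * r + card (A0 - A') * real D" using eG by linarith
    then have "(\<delta> / 8 * N) * D \<le> card (A0 - A') * real D"
      by (simp add: r_def algebra_simps)
    then have "\<delta> / 8 * N \<le> card (A0 - A')" using D by (simp add: mult_le_cancel_right)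
    \<comment> \<open>The container property without the constraints \<open>G\<close> is the
      stronger one, so the next round may start from \<open>{}\<close>.\<close>
    from container_mono[OF leaf[OF A'A0 this], of G k] show "container m G A' k" by simp
  qed
  then show ?thesis
  proof (rule container_mono)
    have "card A \<le> card V" by (rule card_mono[OF finite_V AV])
    then have "real (card A) \<le> N" using N by linarith
    then have "card A / r \<le> N / r" using r by (simp add: divide_right_mono)
    also have "N / r = 8 * N / (\<delta> * D)" by (simp add: r_def)
    finally show "k + card A / r \<le> k + 8 * N / (\<delta> * D)" by simp
  qed auto
qed

text \<open>The potential is \<open>N * D - card G\<close>. It never becomes negative because
  degrees in \<open>G\<close> are at most \<open>D\<close>, and every point put into the fingerprint
  lowers it by at least \<open>\<delta> / 2 * d\<close>; this yields the last summand of the budget.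
  The middle summand pays for the graph phase.\<close>

lemma container_triple_phase:
  assumes inv: "link_graph D A0 G A" and A0: "A0 \<subseteq> V" and N: "real (card V) \<le> N"
    and D: "0 < D" and \<delta>: "0 < \<delta>" and Npos: "0 < N" and d: "0 < d" and k: "0 \<le> k"
    and deg: "\<And>v. real (card {t\<in>H. v \<in> t}) \<le> d"
    and leaf: "\<And>A'. \<lbrakk>A' \<subseteq> A0; \<delta> / 8 * N \<le> card (A0 - A')\<rbrakk> \<Longrightarrow> container (\<delta> * N * d) {} A' k"
  shows "container (\<delta> * N * d) G A (k + 8 * N / (\<delta> * D) + (N * D - card G) / (\<delta> / 2 * d))"
  using inv
proof (induction "card A" arbitrary: A G rule: less_induct)
  case less
  note inv = less.prems
  have finA0: "finite A0" using A0 finite_V finite_subset by blast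
  have AV: "A \<subseteq> V" "A \<subseteq> A0" using inv A0 by (auto simp: link_graph_def)
  have finA: "finite A" using AV finite_V finite_subset by blast
  have pos1: "0 \<le> 8 * N / (\<delta> * D)" using \<delta> Npos by simp
  have "2 * card G = (\<Sum>a\<in>V. gdeg G a)"
    by (rule sum_gdeg[symmetric]) (use finite_V inv A0 in \<open>auto simp: link_graph_def\<close>)
  also have "\<dots> \<le> (\<Sum>a\<in>V. D)" by (rule sum_mono) (use inv in \<open>auto simp: link_graph_def\<close>)
  finally have "card G \<le> card V * D" by simp
  then have "real (card G) \<le> real (card V) * D" by (metis of_nat_le_iff of_nat_mult)
  also have "\<dots> \<le> N * D" using N by (simp add: mult_right_mono)
  finally have pos2: "0 \<le> (N * D - card G) / (\<delta> / 2 * d)" using \<delta> d by simp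
  define S where "S = {a\<in>V. D \<le> gdeg G a}"
  \<comment> \<open>The phase ends with few triples left, with a constant proportion of points lost,
    or with many saturated points; otherwise some point lies in many triples without saturated
    points.\<close>
  consider "real (card {t\<in>H. t \<subseteq> A}) \<le> \<delta> * N * d" | "\<delta> / 8 * N \<le> card (A0 - A)" | "\<delta> / 2 * N \<le> card S"
    | "\<delta> * N * d < real (card {t\<in>H. t \<subseteq> A})" "card S < \<delta> / 2 * N" by linarith
  then show ?case
  proof cases
    case 1
    show ?thesis by (rule container_leaf[OF 1]) (use k pos1 pos2 in linarith)
  next
    case 2
    show ?thesis by (rule container_mono[OF leaf[OF AV(2) 2]]) (use pos1 pos2 in auto)
  next
    case 3
    show ?thesis
      by (rule container_mono[OF container_saturated[OF inv A0 N D \<delta> 3[unfolded S_def] leaf]])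
        (use pos2 in auto)
  next
    case 4
    define H' where "H' = {t\<in>H. t \<subseteq> A \<and> (\<forall>a\<in>t. gdeg G a < D)}"
    have fS: "finite S" unfolding S_def using finite_V by auto
    have fH': "finite H'" unfolding H'_def using finite_H by auto
    \<comment> \<open>A triple in \<open>A\<close> outside \<open>H'\<close> contains a saturated
      point. There are fewer than \<open>\<delta> / 2 * N\<close> of these, each in at most
      \<open>d\<close> triples, so more than \<open>\<delta> / 2 * N * d\<close> triples survive in
      \<open>H'\<close>.\<close>
    have sub1: "{t\<in>H. t \<subseteq> A} \<subseteq> H' \<union> (\<Union>a\<in>S. {t\<in>H. a \<in> t})"
      using H_sub by (force simp: H'_def S_def not_less)
    have "card {t\<in>H. t \<subseteq> A} \<le> card (H' \<union> (\<Union>a\<in>S. {t\<in>H. a \<in> t}))"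
      by (rule card_mono[OF _ sub1]) (use fH' fS finite_H in auto)
    also have "\<dots> \<le> card H' + card (\<Union>a\<in>S. {t\<in>H. a \<in> t})" by (rule card_Un_le)
    also have "\<dots> \<le> card H' + (\<Sum>a\<in>S. card {t\<in>H. a \<in> t})" by (intro add_mono card_UN_le fS) auto
    finally have "real (card {t\<in>H. t \<subseteq> A}) \<le> card H' + (\<Sum>a\<in>S. real (card {t\<in>H. a \<in> t}))"
      by (simp flip: of_nat_sum of_nat_add)
    also have "(\<Sum>a\<in>S. real (card {t\<in>H. a \<in> t})) \<le> (\<Sum>a\<in>S. d)" by (rule sum_mono) (rule deg)
    also have "\<dots> = card S * d" by simp
    also have "\<dots> \<le> \<delta> / 2 * N * d" using 4(2) d by (intro mult_right_mono) auto
    finally have H'big: "\<delta> / 2 * N * d < card H'" using 4(1) by simp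
    \<comment> \<open>Averaging over \<open>A\<close>: if all degrees were smaller, they would sum
      to too little to cover \<open>H'\<close>.\<close>
    have "\<exists>v\<in>A. \<delta> / 2 * d \<le> card {t\<in>H'. v \<in> t}"
    proof (rule ccontr)
      assume "\<not> ?thesis"
      then have lt: "\<And>v. v \<in> A \<Longrightarrow> card {t\<in>H'. v \<in> t} \<le> \<delta> / 2 * d" by force
      have "H' \<subseteq> (\<Union>v\<in>A. {t\<in>H'. v \<in> t})"
      proof
        fix t assume t: "t \<in> H'"
        then have "card t = 3" "t \<subseteq> A" using H_card by (auto simp: H'_def)
        then show "t \<in> (\<Union>v\<in>A. {t\<in>H'. v \<in> t})" using t by (cases "t = {}") auto
      qed
      then have "card H' \<le> card (\<Union>v\<in>A. {t\<in>H'. v \<in> t})"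
        by (rule card_mono[rotated]) (use finA fH' in auto)
      also have "\<dots> \<le> (\<Sum>v\<in>A. card {t\<in>H'. v \<in> t})" by (rule card_UN_le[OF finA])
      finally have "real (card H') \<le> (\<Sum>v\<in>A. real (card {t\<in>H'. v \<in> t}))"
        by (simp flip: of_nat_sum)
      also have "\<dots> \<le> (\<Sum>v\<in>A. \<delta> / 2 * d)" by (rule sum_mono) (rule lt)
      also have "\<dots> = card A * (\<delta> / 2 * d)" by simp
      also have "\<dots> \<le> N * (\<delta> / 2 * d)"
      proof (rule mult_right_mono)
        have "card A \<le> card V" by (rule card_mono[OF finite_V AV(1)])
        then show "real (card A) \<le> N" using N by linarith
      qed (use \<delta> d in simp)
      finally show False using H'big by (simp add: algebra_simps)
    qed
    then obtain v where v: "v \<in> A" "\<delta> / 2 * d \<le> card {t\<in>H'. v \<in> t}" by blast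
    define L where "L = (\<lambda>t. t - {v}) ` {t\<in>H'. v \<in> t}"
    have ext: "link_graph D A0 (G \<union> L) (A - {v})" "card (G \<union> L) = card G + card {t\<in>H'. v \<in> t}"
      using link_graph_extend[OF inv A0 v(1)] by (auto simp: L_def H'_def)
    have smaller: "card (A - {v}) < card A" using v(1) finA by (meson card_Diff1_less)
    show ?thesis
    proof (rule container_branch[OF finA, where v = v and G' = "G \<union> L" and A' = "A - {v}"])
      show "container (\<delta> * N * d) G (A - {v}) (k + 8 * N / (\<delta> * D) + (N * D - card G) / (\<delta> / 2 * d))"
        by (rule less.hyps[OF smaller]) (use inv in \<open>auto simp: link_graph_def\<close>)
      have "container (\<delta> * N * d) (G \<union> L) (A - {v})
              (k + 8 * N / (\<delta> * D) + (N * D - card (G \<union> L)) / (\<delta> / 2 * d))"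
        by (rule less.hyps[OF smaller ext(1)])
      then show "container (\<delta> * N * d) (G \<union> L) (A - {v})
              (k + 8 * N / (\<delta> * D) + (N * D - card G) / (\<delta> / 2 * d) - 1)"
      proof (rule container_mono)
        have "(N * D - card (G \<union> L)) / (\<delta> / 2 * d) \<le> (N * D - card G - \<delta> / 2 * d) / (\<delta> / 2 * d)"
          using v(2) ext(2) \<delta> d by (intro divide_right_mono) auto
        also have "\<dots> = (N * D - card G) / (\<delta> / 2 * d) - 1"
          using \<delta> d by (simp add: diff_divide_distrib)
        finally show "k + 8 * N / (\<delta> * D) + (N * D - card (G \<union> L)) / (\<delta> / 2 * d)
          \<le> k + 8 * N / (\<delta> * D) + (N * D - card G) / (\<delta> / 2 * d) - 1" by simp
      qed auto
    next
      fix I assume I: "I \<subseteq> A" "v \<in> I" "\<forall>t\<in>H. \<not> t \<subseteq> I" "\<forall>e\<in>G. \<not> e \<subseteq> I"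
      \<comment> \<open>With \<open>v\<close> in \<open>I\<close>, a link of \<open>v\<close> inside
        \<open>I\<close> would complete a triple of \<open>H\<close> inside
        \<open>I\<close>.\<close>
      have *: "\<not> e \<subseteq> I" if "e \<in> L" for e
      proof
        assume "e \<subseteq> I"
        from that obtain t where "t \<in> H'" "v \<in> t" "e = t - {v}" by (auto simp: L_def)
        with \<open>e \<subseteq> I\<close> I show False by (auto simp: H'_def)
      qed
      have "\<not> e \<subseteq> I - {v}" if "e \<in> G \<union> L" for e
        using that * I(4) by blast
      then show "I - {v} \<subseteq> A - {v} \<and> (\<forall>e\<in>G \<union> L. \<not> e \<subseteq> I - {v})" using I(1) by blast
    qed
  qed
qed

text \<open>Every round that does not end in a leaf removes at least \<open>\<delta> / 8 * N\<close>
  points, so there are at most \<open>8 * card A / (\<delta> * N) + 1\<close> rounds, each adding at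
  most \<open>12 * N / (\<delta> * sqrt d)\<close> points to the fingerprint.\<close>

lemma container_iterate:
  assumes "A \<subseteq> V" and N: "real (card V) \<le> N" "0 < N" and \<delta>: "0 < \<delta>" and d: "1 \<le> d"
    and deg: "\<And>v. real (card {t\<in>H. v \<in> t}) \<le> d"
  shows "container (\<delta> * N * d) {} A (12 * N / (\<delta> * sqrt d) * (8 * card A / (\<delta> * N) + 1))"
  using assms(1)
proof (induction "card A" arbitrary: A rule: less_induct)
  case less
  have finA: "finite A" using less.prems finite_V finite_subset by blast
  define K where "K = 12 * N / (\<delta> * sqrt d)"
  have K: "0 < K" using N \<delta> d by (simp add: K_def)
  \<comment> \<open>This \<open>D\<close> balances the costs \<open>8 * N / (\<delta> * D)\<close>
    and \<open>2 * N * D / (\<delta> * d)\<close> of the two phases. Together they give the constant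
    12 = 8 + 4, where the 4 includes a factor 2 lost to rounding.\<close>
  define D where "D = nat \<lceil>sqrt d\<rceil>"
  have sd: "1 \<le> sqrt d" using d by simp
  have D: "sqrt d \<le> D" "real D \<le> 2 * sqrt d" "0 < D" using sd unfolding D_def by linarith+
  define k where "k = K * (8 * card A / (\<delta> * N))"
  have k: "0 \<le> k" using K N \<delta> by (simp add: k_def)
  have "container (\<delta> * N * d) {} A (k + 8 * N / (\<delta> * D) + (N * D - card ({} :: 'a set set)) / (\<delta> / 2 * d))"
  proof (rule container_triple_phase[OF _ less.prems N(1) D(3) \<delta> N(2) _ k deg])
    show "link_graph D A {} A" by (auto simp: link_graph_def gdeg_def)
    show "0 < d" using d by simp
    fix A' assume A': "A' \<subseteq> A" "\<delta> / 8 * N \<le> card (A - A')"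
    have cd: "real (card (A - A')) = real (card A) - card A'"
      using A'(1) finA by (simp add: card_Diff_subset card_mono finite_subset of_nat_diff)
    have "0 < \<delta> / 8 * N" using \<delta> N by simp
    then have "card A' < card A" using cd A'(2) by linarith
    then have "container (\<delta> * N * d) {} A' (K * (8 * card A' / (\<delta> * N) + 1))"
      unfolding K_def using A' less.prems by (intro less.hyps) auto
    then show "container (\<delta> * N * d) {} A' k"
    proof (rule container_mono)
      have "8 * card A' / (\<delta> * N) + 1 = (8 * card A' + \<delta> * N) / (\<delta> * N)"
        using \<delta> N by (simp add: add_divide_distrib)
      also have "\<dots> \<le> 8 * card A / (\<delta> * N)"
        using A'(2) cd \<delta> N by (intro divide_right_mono) auto
      finally have "8 * card A' / (\<delta> * N) + 1 \<le> 8 * card A / (\<delta> * N)" .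
      then show "K * (8 * card A' / (\<delta> * N) + 1) \<le> k"
        unfolding k_def by (rule mult_left_mono) (use K in simp)
    qed auto
  qed
  then show ?case
  proof (rule container_mono)
    have "8 * N / (\<delta> * D) \<le> 8 * N / (\<delta> * sqrt d)"
    proof (rule divide_left_mono)
      show "\<delta> * sqrt d \<le> \<delta> * D" using D(1) \<delta> by simp
      show "0 \<le> 8 * N" using N by simp
      show "0 < \<delta> * D * (\<delta> * sqrt d)" using D(3) sd d \<delta> by simp
    qed
    moreover have "(N * D - card ({} :: 'a set set)) / (\<delta> / 2 * d) \<le> N * (2 * sqrt d) / (\<delta> / 2 * d)"
      using D N \<delta> d by (intro divide_right_mono) auto
    moreover have "N * (2 * sqrt d) / (\<delta> / 2 * d) = 4 * N / (\<delta> * sqrt d)"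
      using sd \<delta> d by (simp add: field_simps)
    moreover have "8 * N / (\<delta> * sqrt d) + 4 * N / (\<delta> * sqrt d) = K"
      by (simp add: K_def flip: add_divide_distrib)
    ultimately show "k + 8 * N / (\<delta> * D) + (N * D - card ({} :: 'a set set)) / (\<delta> / 2 * d)
      \<le> 12 * N / (\<delta> * sqrt d) * (8 * card A / (\<delta> * N) + 1)"
      by (simp add: k_def K_def algebra_simps)
  qed auto
qed

text \<open>Starting from all of \<open>V\<close>, \<open>card V \<le> N\<close> bounds the number
  of rounds by a constant depending only on \<open>\<delta>\<close>.\<close>

theorem linear_triples_containers:
  assumes N: "real (card V) \<le> N" "0 < N" and \<delta>: "0 < \<delta>" and d: "1 \<le> d"
    and deg: "\<And>v. real (card {t\<in>H. v \<in> t}) \<le> d"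
  shows "\<exists>g. \<forall>I\<subseteq>V. (\<forall>t\<in>H. \<not> t \<subseteq> I) \<longrightarrow>
     (\<exists>T\<subseteq>I. real (card T) \<le> 12 * (8 / \<delta> + 1) / \<delta> * (N / sqrt d) \<and> I \<subseteq> T \<union> g T \<and>
       real (card {t\<in>H. t \<subseteq> g T}) \<le> \<delta> * N * d)"
proof -
  have "container (\<delta> * N * d) {} V (12 * (8 / \<delta> + 1) / \<delta> * (N / sqrt d))"
  proof (rule container_mono[OF container_iterate[OF order_refl assms]])
    have "8 * card V / (\<delta> * N) \<le> 8 / \<delta>" using N \<delta> by (simp add: field_simps)
    then have "12 * N / (\<delta> * sqrt d) * (8 * card V / (\<delta> * N) + 1) \<le> 12 * N / (\<delta> * sqrt d) * (8 / \<delta> + 1)"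
      using N \<delta> d by (intro mult_left_mono) auto
    also have "\<dots> = 12 * (8 / \<delta> + 1) / \<delta> * (N / sqrt d)" by simp
    finally show "12 * N / (\<delta> * sqrt d) * (8 * card V / (\<delta> * N) + 1) \<le> 12 * (8 / \<delta> + 1) / \<delta> * (N / sqrt d)" .
  qed auto
  then show ?thesis unfolding container_def by simp
qed

end

section \<open>Supersaturation\<close>

lemma nsets_2_triple:
  assumes "a \<noteq> b" "a \<noteq> c" "b \<noteq> c"
  shows "[{a,b,c}]\<^bsup>2\<^esup> = {{a,b},{a,c},{b,c}}"
proof
  show "[{a,b,c}]\<^bsup>2\<^esup> \<subseteq> {{a,b},{a,c},{b,c}}"
  proof
    fix e assume "e \<in> [{a,b,c}]\<^bsup>2\<^esup>"
    then obtain x y where "e = {x,y}" "x \<noteq> y" "x \<in> {a,b,c}" "y \<in> {a,b,c}"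
      by (auto simp: nsets_def card_2_iff)
    then show "e \<in> {{a,b},{a,c},{b,c}}" by (auto simp: insert_commute)
  qed
qed (use assms in \<open>auto simp: nsets_def\<close>)

text \<open>Each pair is charged with all of \<open>e \<times> e\<close>, hence the crude factor 4;
  for triples it becomes 27 in the same way.\<close>

lemma card_ordered_pairs_le:
  assumes "finite U" "\<And>e. e \<in> U \<Longrightarrow> card e = 2"
  shows "card {(a,b). {a,b} \<in> U} \<le> 4 * card U" "finite {(a,b). {a,b} \<in> U}"
proof -
  have fin: "finite e" if "e \<in> U" for e using assms(2)[OF that] by (simp add: card_ge_0_finite)
  have sub: "{(a,b). {a,b} \<in> U} \<subseteq> (\<Union>e\<in>U. e \<times> e)" by auto
  have fU: "finite (\<Union>e\<in>U. e \<times> e)" using assms(1) fin by auto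
  show "finite {(a,b). {a,b} \<in> U}" by (rule finite_subset[OF sub fU])
  have "card {(a,b). {a,b} \<in> U} \<le> card (\<Union>e\<in>U. e \<times> e)" by (rule card_mono[OF fU sub])
  also have "\<dots> \<le> (\<Sum>e\<in>U. card (e \<times> e))" by (rule card_UN_le[OF assms(1)])
  also have "\<dots> = (\<Sum>e\<in>U. 4)" by (rule sum.cong) (auto simp: assms(2) card_cartesian_product)
  finally show "card {(a,b). {a,b} \<in> U} \<le> 4 * card U" by simp
qed

lemma card_ordered_triples_le:
  assumes "finite U" "\<And>e. e \<in> U \<Longrightarrow> card e = 3"
  shows "card {(a,b,c). {a,b,c} \<in> U} \<le> 27 * card U" "finite {(a,b,c). {a,b,c} \<in> U}"
proof -
  have fin: "finite e" if "e \<in> U" for e using assms(2)[OF that] by (simp add: card_ge_0_finite)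
  have sub: "{(a,b,c). {a,b,c} \<in> U} \<subseteq> (\<Union>e\<in>U. e \<times> e \<times> e)" by auto
  have fU: "finite (\<Union>e\<in>U. e \<times> e \<times> e)" using assms(1) fin by auto
  show "finite {(a,b,c). {a,b,c} \<in> U}" by (rule finite_subset[OF sub fU])
  have "card {(a,b,c). {a,b,c} \<in> U} \<le> card (\<Union>e\<in>U. e \<times> e \<times> e)" by (rule card_mono[OF fU sub])
  also have "\<dots> \<le> (\<Sum>e\<in>U. card (e \<times> e \<times> e))" by (rule card_UN_le[OF assms(1)])
  also have "\<dots> = (\<Sum>e\<in>U. 27)" by (rule sum.cong) (auto simp: assms(2) card_cartesian_product)
  finally show "card {(a,b,c). {a,b,c} \<in> U} \<le> 27 * card U" by simp
qed

lemma card_image_Times_le: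
  assumes "finite A" "finite B"
  shows "card (f ` (A \<times> B)) \<le> card A * card B"
  using card_image_le[of "A \<times> B" f] assms by (simp add: card_cartesian_product)

text \<open>Convexity of the cube: on nonnegative arguments its graph lies above the tangent at
  \<open>m\<close>, and summing the tangent inequality leaves only the linear sum.\<close>

lemma sum_cubes_ge:
  fixes f :: "'a \<Rightarrow> real" and m :: real
  assumes "finite Y" "\<And>y. y \<in> Y \<Longrightarrow> 0 \<le> f y" "0 \<le> m" "m * card Y \<le> (\<Sum>y\<in>Y. f y)"
  shows "m ^ 3 * card Y \<le> (\<Sum>y\<in>Y. f y ^ 3)"
proof -
  have tangent: "3 * m\<^sup>2 * a - 2 * m ^ 3 \<le> a ^ 3" if "0 \<le> a" for a :: real
  proof -
    have "a ^ 3 - (3 * m\<^sup>2 * a - 2 * m ^ 3) = (a - m)\<^sup>2 * (a + 2 * m)"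
      by (simp add: algebra_simps power2_eq_square power3_eq_cube)
    also have "\<dots> \<ge> 0" using that assms(3) by simp
    finally show ?thesis by simp
  qed
  have "m ^ 3 * card Y = 3 * m\<^sup>2 * (m * card Y) - 2 * m ^ 3 * card Y"
    by (simp add: algebra_simps power2_eq_square power3_eq_cube)
  also have "\<dots> \<le> 3 * m\<^sup>2 * (\<Sum>y\<in>Y. f y) - 2 * m ^ 3 * card Y"
    by (intro diff_right_mono mult_left_mono assms(4)) auto
  also have "\<dots> = (\<Sum>y\<in>Y. 3 * m\<^sup>2 * f y - 2 * m ^ 3)"
    by (simp add: sum_subtractf sum_distrib_left)
  also have "\<dots> \<le> (\<Sum>y\<in>Y. f y ^ 3)" by (intro sum_mono tangent assms(2))
  finally show ?thesis .
qed

text \<open>For \<open>P\<close> the red edges these are the triangles of the red alternative in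
  \<open>K3_rich\<close>; with \<open>Y\<close> for \<open>X\<close> and the blue edges, those of
  the blue one.\<close>

definition touching :: "'a set \<Rightarrow> 'a set \<Rightarrow> 'a set set \<Rightarrow> 'a set set" where
  "touching Z X P = {T \<in> [Z]\<^bsup>3\<^esup>. T \<inter> X \<noteq> {} \<and> [T]\<^bsup>2\<^esup> \<subseteq> P}"

text \<open>Three \<open>Q\<close>-neighbours in \<open>X\<close> of a vertex \<open>y \<in> Y\<close> span a missing pair, a \<open>P\<close>-triangle inside \<open>X\<close>,
  or a \<open>Q\<close>-triangle through \<open>y\<close>; count the quadruples.\<close>

lemma neighbour_triples_bound:
  fixes P :: "'a set set"
  assumes fin: "finite X" "finite Y" and disj: "X \<inter> Y = {}" and s: "card X = s" "card Y = s"
    and Q: "real (s\<^sup>2) / 3 \<le> card {(x,y) \<in> X \<times> Y. {x,y} \<in> Q}"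
  defines "U \<equiv> [X \<union> Y]\<^bsup>2\<^esup> - (P \<union> Q)"
  shows "real s ^ 4 / 27 \<le> 3 * real s ^ 3 + 12 * real (card U) * real s ^ 2
           + 27 * real (card (touching (X \<union> Y) X P)) * real s
           + 81 * real (card (touching (X \<union> Y) Y Q)) * real s"
proof -
  \<comment> \<open>Ordered triples of \<open>Q\<close>-neighbours, repetitions allowed, so that the
    size of \<open>W\<close> is the sum of the cubed degrees.\<close>
  define W where "W = (SIGMA y:Y. let q = {x\<in>X. {x,y} \<in> Q} in q \<times> q \<times> q)"
  define TP where "TP = touching (X \<union> Y) X P"
  define TQ where "TQ = touching (X \<union> Y) Y Q"
  define OU where "OU = {(a,b). {a,b} \<in> U}"
  define OP where "OP = {(a,b,c). {a,b,c} \<in> TP}"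
  define OQ where "OQ = {(a,b,c). {a,b,c} \<in> TQ}"
  have finT: "finite TP" "finite TQ"
    unfolding TP_def TQ_def touching_def using fin by (auto simp: finite_imp_finite_nsets)
  have finU: "finite U" unfolding U_def using fin by (auto simp: finite_imp_finite_nsets)
  have OU: "card OU \<le> 4 * card U" "finite OU" unfolding OU_def
    by (rule card_ordered_pairs_le[OF finU]; auto simp: U_def nsets_def)+
  have OP: "card OP \<le> 27 * card TP" "finite OP" unfolding OP_def
    by (rule card_ordered_triples_le[OF finT(1)]; auto simp: TP_def touching_def nsets_def)+
  have OQ: "card OQ \<le> 27 * card TQ" "finite OQ" unfolding OQ_def
    by (rule card_ordered_triples_le[OF finT(2)]; auto simp: TQ_def touching_def nsets_def)+
  \<comment> \<open>\<open>D1\<close>, \<open>D2\<close>, \<open>D3\<close> cover the quadruples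
    with a repeated entry, \<open>U1\<close>, \<open>U2\<close>, \<open>U3\<close> those with a
    missing pair, \<open>T0\<close> those with a \<open>P\<close>-triangle in \<open>X\<close>, and
    \<open>T1\<close>, \<open>T2\<close>, \<open>T3\<close> those with a \<open>Q\<close>-triangle
    through \<open>y\<close>.\<close>
  define D1 D2 D3 where "D1 = (\<lambda>((a,c),y). (y,a,a,c)) ` ((X \<times> X) \<times> Y)"
    and "D2 = (\<lambda>((a,c),y). (y,a,c,a)) ` ((X \<times> X) \<times> Y)"
    and "D3 = (\<lambda>((a,c),y). (y,c,a,a)) ` ((X \<times> X) \<times> Y)"
  define U1 U2 U3 where "U1 = (\<lambda>((a,b),c,y). (y,a,b,c)) ` (OU \<times> (X \<times> Y))"
    and "U2 = (\<lambda>((a,b),c,y). (y,a,c,b)) ` (OU \<times> (X \<times> Y))"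
    and "U3 = (\<lambda>((a,b),c,y). (y,c,a,b)) ` (OU \<times> (X \<times> Y))"
  define T0 T1 T2 T3 where "T0 = (\<lambda>((a,b,c),y). (y,a,b,c)) ` (OP \<times> Y)"
    and "T1 = (\<lambda>((a,b,y),c). (y,a,b,c)) ` (OQ \<times> X)"
    and "T2 = (\<lambda>((a,b,y),c). (y,a,c,b)) ` (OQ \<times> X)"
    and "T3 = (\<lambda>((a,b,y),c). (y,c,a,b)) ` (OQ \<times> X)"
  have cards: "card D1 \<le> s ^ 3" "card D2 \<le> s ^ 3" "card D3 \<le> s ^ 3"
    unfolding D1_def D2_def D3_def
    using card_image_Times_le[of "X \<times> X" Y] fin s by (simp_all add: card_cartesian_product power3_eq_cube)
  have cards': "card U1 \<le> 4 * card U * s\<^sup>2" "card U2 \<le> 4 * card U * s\<^sup>2" "card U3 \<le> 4 * card U * s\<^sup>2"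
    unfolding U1_def U2_def U3_def
    by (rule order_trans[OF card_image_Times_le];
        use fin s OU in \<open>simp add: card_cartesian_product power2_eq_square mult_right_mono\<close>)+
  have cards'': "card T0 \<le> 27 * card TP * s" "card T1 \<le> 27 * card TQ * s"
      "card T2 \<le> 27 * card TQ * s" "card T3 \<le> 27 * card TQ * s"
    unfolding T0_def T1_def T2_def T3_def
    by (rule order_trans[OF card_image_Times_le]; use fin s OP OQ in \<open>simp add: mult_right_mono\<close>)+
  have fins: "finite D1" "finite D2" "finite D3" "finite U1" "finite U2" "finite U3"
      "finite T0" "finite T1" "finite T2" "finite T3"
    unfolding D1_def D2_def D3_def U1_def U2_def U3_def T0_def T1_def T2_def T3_def
    using fin OU OP OQ by auto
  have sub: "W \<subseteq> D1 \<union> D2 \<union> D3 \<union> U1 \<union> U2 \<union> U3 \<union> T0 \<union> T1 \<union> T2 \<union> T3"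
  proof
    fix w assume w: "w \<in> W"
    obtain y a b c where w_eq: "w = (y,a,b,c)" by (metis prod_cases4)
    have yabc: "y \<in> Y" "a \<in> X" "b \<in> X" "c \<in> X" "{a,y} \<in> Q" "{b,y} \<in> Q" "{c,y} \<in> Q"
      using w by (auto simp: W_def w_eq Let_def)
    have XY: "x \<noteq> y" if "x \<in> X" for x using that yabc(1) disj by auto
    \<comment> \<open>If \<open>{u,v}\<close> is in \<open>Q\<close>, it forms with \<open>y\<close>
      a \<open>Q\<close>-triangle touching \<open>Y\<close>; if it is in neither \<open>P\<close>
      nor \<open>Q\<close>, it is missing. Only \<open>P\<close> remains, and if all three pairs
      fall there they form a \<open>P\<close>-triangle touching \<open>X\<close>.\<close>
    have UPQ: "(u,v) \<in> OU \<or> {u,v} \<in> P \<or> (u,v,y) \<in> OQ"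
      if uv: "u \<in> X" "v \<in> X" "u \<noteq> v" "{u,y} \<in> Q" "{v,y} \<in> Q" for u v
    proof (cases "{u,v} \<in> Q")
      case True
      then have "{u,v,y} \<in> TQ"
        using uv XY[of u] XY[of v] yabc(1) nsets_2_triple[of u v y]
        by (auto simp: TQ_def touching_def nsets_def)
      then show ?thesis by (simp add: OQ_def)
    next
      case False
      then show ?thesis using uv by (auto simp: OU_def U_def nsets_def)
    qed
    have PPP: "(a,b,c) \<in> OP" if "a \<noteq> b" "a \<noteq> c" "b \<noteq> c" "{a,b} \<in> P" "{a,c} \<in> P" "{b,c} \<in> P"
      using that yabc nsets_2_triple[of a b c] by (auto simp: OP_def TP_def touching_def nsets_def)
    have mem: "a = b \<Longrightarrow> w \<in> D1" "a = c \<Longrightarrow> w \<in> D2" "b = c \<Longrightarrow> w \<in> D3"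
      "(a,b) \<in> OU \<Longrightarrow> w \<in> U1" "(a,c) \<in> OU \<Longrightarrow> w \<in> U2" "(b,c) \<in> OU \<Longrightarrow> w \<in> U3"
      "(a,b,c) \<in> OP \<Longrightarrow> w \<in> T0"
      "(a,b,y) \<in> OQ \<Longrightarrow> w \<in> T1" "(a,c,y) \<in> OQ \<Longrightarrow> w \<in> T2" "(b,c,y) \<in> OQ \<Longrightarrow> w \<in> T3"
      unfolding D1_def D2_def D3_def U1_def U2_def U3_def T0_def T1_def T2_def T3_def w_eq
      using yabc by (force simp: image_iff)+
    show "w \<in> D1 \<union> D2 \<union> D3 \<union> U1 \<union> U2 \<union> U3 \<union> T0 \<union> T1 \<union> T2 \<union> T3"
      using UPQ[of a b] UPQ[of a c] UPQ[of b c] PPP mem yabc by blast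
  qed
  define q where "q y = card {x\<in>X. {x,y} \<in> Q}" for y
  have "{(x,y) \<in> X \<times> Y. {x,y} \<in> Q} = (\<lambda>(y,x). (x,y)) ` (SIGMA y:Y. {x\<in>X. {x,y} \<in> Q})"
    by (auto simp: image_iff)
  then have "card {(x,y) \<in> X \<times> Y. {x,y} \<in> Q} = card (SIGMA y:Y. {x\<in>X. {x,y} \<in> Q})"
    by (simp add: card_image inj_on_def split_def prod_eq_iff)
  also have "\<dots> = (\<Sum>y\<in>Y. q y)" unfolding q_def using fin by (simp add: card_SigmaI)
  finally have qsum: "real (s\<^sup>2) / 3 \<le> (\<Sum>y\<in>Y. real (q y))" using Q by simp
  \<comment> \<open>The \<open>Q\<close>-degrees of the \<open>s\<close> vertices of
    \<open>Y\<close> average at least \<open>s / 3\<close>.\<close>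
  have "(real s / 3) ^ 3 * card Y \<le> (\<Sum>y\<in>Y. real (q y) ^ 3)"
    by (rule sum_cubes_ge) (use fin s qsum in \<open>auto simp: power2_eq_square\<close>)
  also have "\<dots> = card W"
    unfolding W_def using fin
    by (simp add: card_SigmaI Let_def card_cartesian_product q_def power3_eq_cube mult.assoc)
  also have "card W \<le> card (D1 \<union> D2 \<union> D3 \<union> U1 \<union> U2 \<union> U3 \<union> T0 \<union> T1 \<union> T2 \<union> T3)"
    by (rule card_mono[OF _ sub]) (use fins in auto)
  also have "\<dots> \<le> card D1 + card D2 + card D3 + card U1 + card U2 + card U3
      + card T0 + card T1 + card T2 + card T3"
    by (intro order_trans[OF card_Un_le] add_mono order_refl)
  also have "\<dots> \<le> 3 * s ^ 3 + 12 * card U * s\<^sup>2 + 27 * card TP * s + 81 * card TQ * s"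
    using cards cards' cards'' by linarith
  finally show ?thesis
    by (simp add: s TP_def TQ_def power_divide eval_nat_numeral algebra_simps)
qed

text \<open>The constants: \<open>(27 + 81) / 11664 = 1 / 108\<close>, and
  \<open>162 \<le> s\<close> gives \<open>3 * s ^ 3 \<le> s ^ 4 / 54\<close>. Since
  \<open>1/27 - 1/54 - 1/108 = 1/108\<close>, at least \<open>s ^ 4 / 108\<close> is left for
  \<open>12 * u * s\<^sup>2\<close>, and \<open>108 * 12 = 1296\<close>.\<close>

lemma uncovered_pairs_aux:
  fixes s u p q :: real
  assumes "162 \<le> s" "p \<le> s ^ 3 / 11664" "q \<le> s ^ 3 / 11664"
    and "s ^ 4 / 27 \<le> 3 * s ^ 3 + 12 * u * s\<^sup>2 + 27 * p * s + 81 * q * s"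
  shows "s\<^sup>2 / 1296 \<le> u"
proof -
  have "27 * p * s + 81 * q * s \<le> 27 * (s ^ 3 / 11664) * s + 81 * (s ^ 3 / 11664) * s"
    using assms(1-3) by (intro add_mono mult_right_mono mult_left_mono) auto
  also have "\<dots> = s ^ 4 / 108" by (simp add: eval_nat_numeral)
  finally have 1: "27 * p * s + 81 * q * s \<le> s ^ 4 / 108" .
  have "162 * s ^ 3 \<le> s * s ^ 3" using assms(1) by (intro mult_right_mono) auto
  then have "3 * s ^ 3 \<le> s ^ 4 / 54" by (simp add: eval_nat_numeral)
  with 1 assms(4) have "s ^ 4 / 108 \<le> 12 * u * s\<^sup>2" by linarith
  moreover have "s\<^sup>2 * (s\<^sup>2 / 1296) = s ^ 4 / 108 / 12" by (simp add: eval_nat_numeral)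
  moreover have "12 * u * s\<^sup>2 = 12 * (s\<^sup>2 * u)" by simp
  ultimately have "s\<^sup>2 * (s\<^sup>2 / 1296) \<le> s\<^sup>2 * u" by linarith
  then show ?thesis by (rule mult_left_le_imp_le) (use assms(1) in simp)
qed

text \<open>At least a third of the cross pairs between \<open>X\<close> and \<open>Y\<close> lies
  in \<open>Q\<close>, or in \<open>P\<close>, or in neither. The first case counts neighbours of
  vertices in \<open>Y\<close>, the second is the same count with the roles exchanged, and the third
  is immediate.\<close>

lemma uncovered_pairs:
  assumes fin: "finite X" "finite Y" and disj: "X \<inter> Y = {}" and s: "card X = s" "card Y = s" "162 \<le> s"
    and P: "card (touching (X \<union> Y) X P) \<le> real s ^ 3 / 11664"
    and Q: "card (touching (X \<union> Y) Y Q) \<le> real s ^ 3 / 11664"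
  shows "(real s)\<^sup>2 / 1296 \<le> card ([X \<union> Y]\<^bsup>2\<^esup> - (P \<union> Q))"
proof -
  define U where "U = [X \<union> Y]\<^bsup>2\<^esup> - (P \<union> Q)"
  define OU where "OU = {(a,b). {a,b} \<in> U}"
  define MP MQ where "MP = {(x,y) \<in> X \<times> Y. {x,y} \<in> P}" and "MQ = {(x,y) \<in> X \<times> Y. {x,y} \<in> Q}"
  have finU: "finite U" unfolding U_def using fin by (auto simp: finite_imp_finite_nsets)
  have OU: "card OU \<le> 4 * card U" "finite OU" unfolding OU_def
    by (rule card_ordered_pairs_le[OF finU]; auto simp: U_def nsets_def)+
  have finM: "finite MP" "finite MQ" unfolding MP_def MQ_def
    by (rule finite_subset[of _ "X \<times> Y"]; use fin in auto)+
  have "X \<times> Y \<subseteq> MP \<union> MQ \<union> OU"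
    using disj by (auto simp: MP_def MQ_def OU_def U_def)
  then have "card (X \<times> Y) \<le> card (MP \<union> MQ \<union> OU)" by (rule card_mono[rotated]) (use finM OU in auto)
  also have "\<dots> \<le> card MP + card MQ + card OU" by (intro order_trans[OF card_Un_le] add_mono order_refl)
  finally have tot: "(real s)\<^sup>2 \<le> real (card MP) + card MQ + 4 * card U"
    using OU(1) s by (simp add: card_cartesian_product power2_eq_square flip: of_nat_mult of_nat_add)
  consider "(real s)\<^sup>2 / 3 \<le> card MQ" | "(real s)\<^sup>2 / 3 \<le> card MP" | "(real s)\<^sup>2 / 3 \<le> 4 * card U"
    using tot by linarith
  then have "(real s)\<^sup>2 / 1296 \<le> card U"
  proof cases
    case 1
    show ?thesis unfolding U_def
      by (rule uncovered_pairs_aux[OF _ P Q neighbour_triples_bound[OF fin disj s(1,2)]])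
        (use 1 s(3) in \<open>simp_all add: MQ_def\<close>)
  next
    case 2
    have "{(x,y) \<in> Y \<times> X. {x,y} \<in> P} = prod.swap ` MP"
      by (auto simp: MP_def image_iff insert_commute)
    then have c: "card {(x,y) \<in> Y \<times> X. {x,y} \<in> P} = card MP"
      by (simp add: card_image)
    have "(real s)\<^sup>2 / 1296 \<le> card ([Y \<union> X]\<^bsup>2\<^esup> - (Q \<union> P))"
      by (rule uncovered_pairs_aux[OF _ _ _ neighbour_triples_bound[OF fin(2,1) _ s(2,1)]])
        (use 2 s(3) P Q disj c in \<open>auto simp: Un_commute Int_commute\<close>)
    then show ?thesis by (simp add: U_def Un_commute)
  next
    case 3
    then show ?thesis using zero_le_power2[of "real s"] by linarith
  qed
  then show ?thesis by (simp add: U_def)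
qed

section \<open>Containers for triangles in random graphs\<close>

definition triangle_edges :: "'a set \<Rightarrow> 'a set \<Rightarrow> 'a set set set" where
  "triangle_edges Z X = (\<lambda>T. [T]\<^bsup>2\<^esup>) ` {T \<in> [Z]\<^bsup>3\<^esup>. T \<inter> X \<noteq> {}}"

lemma Union_nsets_2:
  assumes "T \<in> [Z]\<^bsup>3\<^esup>" shows "\<Union>([T]\<^bsup>2\<^esup>) = T"
proof -
  obtain a b c where "T = {a,b,c}" "a \<noteq> b" "a \<noteq> c" "b \<noteq> c"
    using assms by (auto simp: nsets_def card_3_iff)
  then show ?thesis using nsets_2_triple[of a b c] by auto
qed

text \<open>Two distinct pairs inside a three-element set have that set as their union, so two edges
  determine the triangle; this gives linearity.\<close>

lemma linear_triples_triangle_edges: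
  assumes "finite Z" shows "linear_triples ([Z]\<^bsup>2\<^esup>) (triangle_edges Z X)"
proof
  show "finite ([Z]\<^bsup>2\<^esup>)" using assms by (rule finite_imp_finite_nsets)
next
  fix t assume "t \<in> triangle_edges Z X"
  then obtain T where T: "T \<in> [Z]\<^bsup>3\<^esup>" "t = [T]\<^bsup>2\<^esup>" by (auto simp: triangle_edges_def)
  then have "T \<subseteq> Z" "card T = 3" by (auto simp: nsets_def)
  then show "t \<subseteq> [Z]\<^bsup>2\<^esup>" "card t = 3"
    using T(2) nsets_mono[of T Z 2] by (simp_all add: choose_two)
next
  fix t t' e assume *: "t \<in> triangle_edges Z X" "t' \<in> triangle_edges Z X" "e \<subseteq> t" "e \<subseteq> t'" "card e = 2"
  obtain T T' where T: "T \<in> [Z]\<^bsup>3\<^esup>" "t = [T]\<^bsup>2\<^esup>" "T' \<in> [Z]\<^bsup>3\<^esup>" "t' = [T']\<^bsup>2\<^esup>"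
    using * by (auto simp: triangle_edges_def)
  obtain p q where pq: "e = {p,q}" "p \<noteq> q" using *(5) by (auto simp: card_2_iff)
  have eq: "p \<union> q = S" if "S \<in> [Z]\<^bsup>3\<^esup>" "p \<in> [S]\<^bsup>2\<^esup>" "q \<in> [S]\<^bsup>2\<^esup>" for S
  proof -
    obtain a b c where abc: "S = {a,b,c}" "a \<noteq> b" "a \<noteq> c" "b \<noteq> c"
      using \<open>S \<in> [Z]\<^bsup>3\<^esup>\<close> by (auto simp: nsets_def card_3_iff)
    have "p \<in> {{a,b},{a,c},{b,c}}" "q \<in> {{a,b},{a,c},{b,c}}"
      using that(2,3) abc nsets_2_triple[of a b c] by simp_all
    then show ?thesis using abc pq(2) by auto
  qed
  have "p \<in> t" "q \<in> t" "p \<in> t'" "q \<in> t'" using *(3,4) pq(1) by simp_all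
  then have "T = T'" using eq[OF T(1)] eq[OF T(3)] T(2,4) by simp
  then show "t = t'" using T by simp
qed

text \<open>A triangle through the pair \<open>e\<close> is determined by its third vertex.\<close>

lemma card_triangle_edges_le:
  assumes "finite Z" shows "card {t \<in> triangle_edges Z X. e \<in> t} \<le> card Z"
proof -
  have "{t \<in> triangle_edges Z X. e \<in> t} \<subseteq> (\<lambda>z. [insert z e]\<^bsup>2\<^esup>) ` Z"
  proof
    fix t assume "t \<in> {t \<in> triangle_edges Z X. e \<in> t}"
    then obtain T where T: "T \<in> [Z]\<^bsup>3\<^esup>" "t = [T]\<^bsup>2\<^esup>" "e \<in> [T]\<^bsup>2\<^esup>" by (auto simp: triangle_edges_def)
    then obtain a b c where abc: "T = {a,b,c}" "a \<noteq> b" "a \<noteq> c" "b \<noteq> c" "{a,b,c} \<subseteq> Z"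
      by (auto simp: nsets_def card_3_iff)
    then have "e \<in> {{a,b},{a,c},{b,c}}" using T(3) nsets_2_triple by metis
    then have "\<exists>z\<in>Z. T = insert z e" using abc by auto
    then show "t \<in> (\<lambda>z. [insert z e]\<^bsup>2\<^esup>) ` Z" using T by auto
  qed
  then show ?thesis by (rule surj_card_le[OF assms])
qed

lemma card_touching_eq: "card (touching Z X P) = card {t \<in> triangle_edges Z X. t \<subseteq> P}"
proof -
  have "{t \<in> triangle_edges Z X. t \<subseteq> P} = (\<lambda>T. [T]\<^bsup>2\<^esup>) ` touching Z X P"
    by (auto simp: triangle_edges_def touching_def)
  moreover have "inj_on (\<lambda>T. [T]\<^bsup>2\<^esup>) (touching Z X P)"
    unfolding touching_def using Union_nsets_2 by (intro inj_on_inverseI[where g = Union]) blast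
  ultimately show ?thesis by (simp add: card_image)
qed

lemma card_nsets_2_le:
  assumes "finite Z" "card Z \<le> n" shows "real (card ([Z]\<^bsup>2\<^esup>)) \<le> (real n)\<^sup>2"
proof -
  have "card Z choose 2 \<le> card Z ^ 2" by (simp add: choose_two power2_eq_square) (meson div_le_dividend diff_le_self le_trans mult_le_mono2)
  also have "\<dots> \<le> n ^ 2" using assms(2) by (rule power_mono) simp
  finally have "real (card ([Z]\<^bsup>2\<^esup>)) \<le> real (n ^ 2)" by (simp del: of_nat_power)
  then show ?thesis by simp
qed

text \<open>The general theorem with \<open>N = n\<^sup>2\<close> and \<open>d = n\<close>:
  fingerprints have order \<open>n\<^sup>2 / sqrt n\<close>, and a container keeps at most
  \<open>\<delta> * n ^ 3\<close> triangles.\<close>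

lemma triangle_containers:
  assumes "finite Z" "card Z \<le> n" "1 \<le> n" "0 < \<delta>"
    and t: "12 * (8 / \<delta> + 1) / \<delta> * real n powr (3/2) \<le> t" and m: "\<delta> * real n ^ 3 \<le> m"
  shows "\<exists>g. \<forall>I\<subseteq>[Z]\<^bsup>2\<^esup>. (\<forall>T\<in>[Z]\<^bsup>3\<^esup>. T \<inter> X \<noteq> {} \<longrightarrow> \<not> [T]\<^bsup>2\<^esup> \<subseteq> I) \<longrightarrow>
    (\<exists>T\<subseteq>I. real (card T) \<le> t \<and> I \<subseteq> T \<union> g T \<and>
      real (card (touching Z X (g T))) \<le> m)"
proof -
  interpret linear_triples "[Z]\<^bsup>2\<^esup>" "triangle_edges Z X"
    by (rule linear_triples_triangle_edges[OF assms(1)])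
  have deg: "real (card {t \<in> triangle_edges Z X. v \<in> t}) \<le> real n" for v
    using card_triangle_edges_le[OF assms(1), of X v] assms(2) by linarith
  have n: "0 < (real n)\<^sup>2" "1 \<le> real n" using assms(3) by auto
  have pow: "(real n)\<^sup>2 / sqrt (real n) = real n powr (3/2)"
  proof -
    have "(real n)\<^sup>2 / sqrt (real n) = real n powr 2 / real n powr (1/2)"
      using n by (simp add: powr_half_sqrt)
    also have "\<dots> = real n powr (2 - 1/2)" by (simp only: powr_diff)
    finally show ?thesis by simp
  qed
  have cub: "\<delta> * (real n)\<^sup>2 * real n = \<delta> * real n ^ 3" by (simp add: eval_nat_numeral)
  obtain g where g: "\<And>I. \<lbrakk>I \<subseteq> [Z]\<^bsup>2\<^esup>; \<forall>t\<in>triangle_edges Z X. \<not> t \<subseteq> I\<rbrakk> \<Longrightarrow>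
     \<exists>T\<subseteq>I. real (card T) \<le> 12 * (8 / \<delta> + 1) / \<delta> * real n powr (3/2) \<and> I \<subseteq> T \<union> g T \<and>
       real (card {t\<in>triangle_edges Z X. t \<subseteq> g T}) \<le> \<delta> * real n ^ 3"
    using linear_triples_containers[OF card_nsets_2_le[OF assms(1,2)] n(1) assms(4) n(2) deg, unfolded pow cub]
    by blast
  show ?thesis
  proof (intro exI[of _ g] allI impI)
    fix I assume I: "I \<subseteq> [Z]\<^bsup>2\<^esup>" "\<forall>T\<in>[Z]\<^bsup>3\<^esup>. T \<inter> X \<noteq> {} \<longrightarrow> \<not> [T]\<^bsup>2\<^esup> \<subseteq> I"
    have "\<forall>t\<in>triangle_edges Z X. \<not> t \<subseteq> I" using I(2) by (auto simp: triangle_edges_def)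
    from g[OF I(1) this] obtain T where "T \<subseteq> I" "real (card T) \<le> t" "I \<subseteq> T \<union> g T"
      "real (card {t\<in>triangle_edges Z X. t \<subseteq> g T}) \<le> m" using t m by (meson order_trans)
    then show "\<exists>T\<subseteq>I. real (card T) \<le> t \<and> I \<subseteq> T \<union> g T \<and> real (card (touching Z X (g T))) \<le> m"
      by (intro exI[of _ T]) (simp add: card_touching_eq)
  qed
qed

section \<open>Union bound over fingerprints in the random graph\<close>

text \<open>The event prescribes \<open>True\<close> on \<open>T\<close> and \<open>False\<close> on
  \<open>U\<close> and leaves the other independent coordinates free, so it is a product
  event.\<close>

lemma gnp_prob_contains_avoids:
  assumes "0 \<le> p" "p \<le> 1" "T \<subseteq> [{..<n}]\<^bsup>2\<^esup>" "U \<subseteq> [{..<n}]\<^bsup>2\<^esup>" "T \<inter> U = {}"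
  shows "measure_pmf.prob (gnp n p) {E. T \<subseteq> E \<and> E \<inter> U = {}} = p ^ card T * (1 - p) ^ card U"
proof -
  define M where "M = [{..<n}]\<^bsup>2\<^esup>"
  have fin: "finite M" unfolding M_def by (simp add: finite_imp_finite_nsets)
  define B where "B e = (if e \<in> T then {True} else if e \<in> U then {False} else UNIV)" for e
  have pre: "(\<lambda>f. {e \<in> M. f e}) -` {E. T \<subseteq> E \<and> E \<inter> U = {}} = Pi M B"
  proof (intro set_eqI iffI)
    fix f assume "f \<in> (\<lambda>f. {e \<in> M. f e}) -` {E. T \<subseteq> E \<and> E \<inter> U = {}}"
    then show "f \<in> Pi M B" by (auto simp: B_def Pi_def)
  next
    fix f assume f: "f \<in> Pi M B"
    have "f e" if "e \<in> T" for e
    proof -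
      have "f e \<in> B e" using f that assms(3) by (auto simp: M_def)
      then show ?thesis using that by (simp add: B_def)
    qed
    moreover have "\<not> f e" if "e \<in> U" for e
    proof -
      have "f e \<in> B e" "e \<notin> T" using f that assms(4,5) by (auto simp: M_def)
      then show ?thesis using that by (simp add: B_def)
    qed
    ultimately show "f \<in> (\<lambda>f. {e \<in> M. f e}) -` {E. T \<subseteq> E \<and> E \<inter> U = {}}"
      using assms(3) by (auto simp: M_def)
  qed
  have "measure_pmf.prob (gnp n p) {E. T \<subseteq> E \<and> E \<inter> U = {}}
      = (\<Prod>e\<in>M. measure_pmf.prob (bernoulli_pmf p) (B e))"
    unfolding gnp_def M_def[symmetric] measure_map_pmf pre by (rule measure_Pi_pmf_Pi[OF fin])
  also have "\<dots> = (\<Prod>e\<in>M. (if e \<in> T then p else 1) * (if e \<in> U then 1 - p else 1))"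
    by (rule prod.cong) (use assms in \<open>auto simp: B_def measure_pmf_single\<close>)
  also have "\<dots> = p ^ card T * (1 - p) ^ card U"
    using fin assms(3,4) by (simp add: prod.distrib prod.If_cases M_def[symmetric] Int_absorb1)
  finally show ?thesis .
qed

text \<open>Exponential tilting: \<open>1 \<le> x powr (card T - t)\<close> on the range of summation.\<close>

lemma sum_small_subsets_le:
  fixes p x t :: real
  assumes "finite M" "0 \<le> p" "0 < x" "x \<le> 1"
  shows "(\<Sum>T | T \<subseteq> M \<and> card T \<le> t. p ^ card T) \<le> (1 / x) powr t * exp (p * x * card M)"
proof -
  have "(\<Sum>T | T \<subseteq> M \<and> card T \<le> t. p ^ card T) \<le> (\<Sum>T | T \<subseteq> M \<and> card T \<le> t. (1 / x) powr t * (p * x) ^ card T)"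
  proof (rule sum_mono)
    fix T assume "T \<in> {T. T \<subseteq> M \<and> card T \<le> t}"
    then have "(1 / x) powr card T \<le> (1 / x) powr t" using assms by (intro powr_mono) auto
    then have "1 \<le> (1 / x) powr t * x ^ card T"
      using assms by (simp add: powr_realpow power_one_over field_simps)
    then have "1 * p ^ card T \<le> ((1 / x) powr t * x ^ card T) * p ^ card T"
      using assms(2) by (intro mult_right_mono) auto
    then show "p ^ card T \<le> (1 / x) powr t * (p * x) ^ card T"
      by (simp add: power_mult_distrib mult_ac)
  qed
  also have "\<dots> \<le> (\<Sum>T\<in>Pow M. (1 / x) powr t * (p * x) ^ card T)"
    by (rule sum_mono2) (use assms in auto)
  also have "\<dots> = (1 / x) powr t * (\<Sum>T\<in>Pow M. (p * x) ^ card T)" by (simp add: sum_distrib_left)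
  \<comment> \<open>Summing over all subsets expands the product of \<open>p * x + 1\<close> over
    \<open>M\<close>.\<close>
  also have "(\<Sum>T\<in>Pow M. (p * x) ^ card T) = (\<Prod>e\<in>M. p * x + 1)"
    using prod_add[OF assms(1), of "\<lambda>_. p * x" "\<lambda>_. 1"] by simp
  also have "\<dots> = (1 + p * x) ^ card M" by (simp add: add.commute)
  also have "\<dots> \<le> exp (p * x) ^ card M"
    by (intro power_mono exp_ge_add_one_self) (use assms in auto)
  also have "\<dots> = exp (p * x * card M)" by (simp flip: exp_of_nat2_mult)
  finally show ?thesis by (simp add: mult_left_mono)
qed

lemma not_rich_witness:
  assumes "\<not> K3_rich V E s"
  obtains c X Y where "X \<subseteq> V" "Y \<subseteq> V" "X \<inter> Y = {}" "card X = s" "card Y = s"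
    "\<And>T. \<lbrakk>T \<in> [X \<union> Y]\<^bsup>3\<^esup>; T \<inter> X \<noteq> {}\<rbrakk> \<Longrightarrow> \<not> [T]\<^bsup>2\<^esup> \<subseteq> {e \<in> E. c e = Red}"
    "\<And>T. \<lbrakk>T \<in> [X \<union> Y]\<^bsup>3\<^esup>; T \<inter> Y \<noteq> {}\<rbrakk> \<Longrightarrow> \<not> [T]\<^bsup>2\<^esup> \<subseteq> {e \<in> E. c e = Blue}"
proof -
  obtain c X Y where *: "X \<subseteq> V" "Y \<subseteq> V" "X \<inter> Y = {}" "card X = s" "card Y = s"
    "\<not> (\<exists>T. T \<subseteq> X \<union> Y \<and> mono_triangle E c Red T \<and> card (T \<inter> X) \<ge> 1)"
    "\<not> (\<exists>T. T \<subseteq> X \<union> Y \<and> mono_triangle E c Blue T \<and> card (T \<inter> Y) \<ge> 1)"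
    using assms unfolding K3_rich_def by blast
  have mono: "T \<subseteq> X \<union> Y \<and> mono_triangle E c k T \<and> card (T \<inter> S) \<ge> 1"
    if "T \<in> [X \<union> Y]\<^bsup>3\<^esup>" "T \<inter> S \<noteq> {}" "[T]\<^bsup>2\<^esup> \<subseteq> {e \<in> E. c e = k}" for T S k
  proof -
    have "finite (T \<inter> S)" "T \<subseteq> X \<union> Y" "card T = 3" using that(1) by (auto simp: nsets_def)
    moreover have "card (T \<inter> S) > 0" using that(2) \<open>finite (T \<inter> S)\<close> by (simp add: card_gt_0_iff)
    ultimately show ?thesis using that(3) by (auto simp: mono_triangle_def)
  qed
  show thesis
  proof (rule that[OF *(1-5), of c])
    fix T assume T: "T \<in> [X \<union> Y]\<^bsup>3\<^esup>"
    show "\<not> [T]\<^bsup>2\<^esup> \<subseteq> {e \<in> E. c e = Red}" if "T \<inter> X \<noteq> {}"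
      using mono[OF T that] *(6) by metis
    show "\<not> [T]\<^bsup>2\<^esup> \<subseteq> {e \<in> E. c e = Blue}" if "T \<inter> Y \<noteq> {}"
      using mono[OF T that] *(7) by metis
  qed
qed

text \<open>Every graph that is not rich yields \<open>X\<close>, \<open>Y\<close> and fingerprints
  \<open>R\<close>, \<open>B\<close> such that it contains \<open>R \<union> B\<close> and avoids
  the remaining uncovered pairs. The factor \<open>4 ^ n\<close> counts the choices of
  \<open>X\<close> and \<open>Y\<close>, the square comes from the two fingerprint sums, and
  \<open>x\<close> is the tilting parameter, left free here.\<close>

lemma gnp_not_rich_le:
  fixes n s :: nat and p \<delta> \<gamma> t x :: real
  assumes n: "1 \<le> n" and s: "162 \<le> s" and \<delta>: "0 < \<delta>" "\<delta> * real n ^ 3 \<le> real s ^ 3 / 11664"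
    and \<gamma>: "\<gamma> * (real n)\<^sup>2 \<le> (real s)\<^sup>2 / 1296"
    and t: "12 * (8 / \<delta> + 1) / \<delta> * real n powr (3/2) \<le> t" "4 * t \<le> \<gamma> * (real n)\<^sup>2"
    and p: "0 \<le> p" "p \<le> 1" and x: "0 < x" "x \<le> 1"
  shows "measure_pmf.prob (gnp n p) {E. \<not> K3_rich {..<n} E s}
    \<le> 4 ^ n * ((1 / x) powr t * exp (p * x * (real n)\<^sup>2))\<^sup>2 * exp (- (p * (\<gamma> * (real n)\<^sup>2 / 2)))"
proof -
  define V where "V = {..<n}"
  define M where "M = [V]\<^bsup>2\<^esup>"
  have finV: "finite V" "card V = n" by (auto simp: V_def)
  have finM: "finite M" unfolding M_def using finV by (simp add: finite_imp_finite_nsets)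
  define Q where "Q Z X h \<longleftrightarrow> (\<forall>I\<subseteq>[Z]\<^bsup>2\<^esup>. (\<forall>T\<in>[Z]\<^bsup>3\<^esup>. T \<inter> X \<noteq> {} \<longrightarrow> \<not> [T]\<^bsup>2\<^esup> \<subseteq> I) \<longrightarrow>
    (\<exists>T\<subseteq>I. real (card T) \<le> t \<and> I \<subseteq> T \<union> h T \<and> real (card (touching Z X (h T))) \<le> real s ^ 3 / 11664))"
    for Z X :: "nat set" and h
  \<comment> \<open>The container function is fixed by \<open>Z\<close> and \<open>X\<close> alone,
    before graph and colouring, as the union bound requires.\<close>
  define g where "g Z X = (SOME h. Q Z X h)" for Z X
  have g: "\<exists>T\<subseteq>I. real (card T) \<le> t \<and> I \<subseteq> T \<union> g Z X T \<and> real (card (touching Z X (g Z X T))) \<le> real s ^ 3 / 11664"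
    if "Z \<subseteq> V" "I \<subseteq> [Z]\<^bsup>2\<^esup>" "\<And>T. \<lbrakk>T \<in> [Z]\<^bsup>3\<^esup>; T \<inter> X \<noteq> {}\<rbrakk> \<Longrightarrow> \<not> [T]\<^bsup>2\<^esup> \<subseteq> I" for Z X I
  proof -
    have "finite Z" "card Z \<le> n"
      using that(1) finV by (auto intro: finite_subset dest: card_mono[rotated])
    then have "\<exists>h. Q Z X h"
      unfolding Q_def by (rule triangle_containers[OF _ _ n \<delta>(1) t(1) \<delta>(2)])
    then have "Q Z X (g Z X)" unfolding g_def by (rule someI_ex)
    then show ?thesis using that(2,3) unfolding Q_def by blast
  qed
  define F where "F = {T. T \<subseteq> M \<and> card T \<le> t}"
  have finF: "finite F" unfolding F_def using finM by auto
  \<comment> \<open>Fingerprint pairs are taken out because they are edges of the graph; all other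
    uncovered pairs must be absent from it.\<close>
  define U where "U X Y R B = [X \<union> Y]\<^bsup>2\<^esup> - (g (X \<union> Y) X R \<union> g (X \<union> Y) Y B) - (R \<union> B)" for X Y R B
  define Ix where "Ix = {(X,Y,R,B) \<in> Pow V \<times> Pow V \<times> F \<times> F. R \<inter> B = {} \<and> \<gamma> * (real n)\<^sup>2 / 2 \<le> card (U X Y R B)}"
  have finIx: "finite Ix" unfolding Ix_def
    by (rule finite_subset[of _ "Pow V \<times> Pow V \<times> F \<times> F"]) (use finV finF in auto)
  define Ev where "Ev = (\<lambda>(X,Y,R,B). {E. R \<union> B \<subseteq> E \<and> E \<inter> U X Y R B = {}})"
  have cover: "{E. \<not> K3_rich {..<n} E s} \<subseteq> (\<Union>i\<in>Ix. Ev i)"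
  proof
    fix E assume "E \<in> {E. \<not> K3_rich {..<n} E s}"
    then have "\<not> K3_rich V E s" by (simp add: V_def)
    then obtain c X Y where XY: "X \<subseteq> V" "Y \<subseteq> V" "X \<inter> Y = {}" "card X = s" "card Y = s"
      and red: "\<And>T. \<lbrakk>T \<in> [X \<union> Y]\<^bsup>3\<^esup>; T \<inter> X \<noteq> {}\<rbrakk> \<Longrightarrow> \<not> [T]\<^bsup>2\<^esup> \<subseteq> {e \<in> E. c e = Red}"
      and blue: "\<And>T. \<lbrakk>T \<in> [X \<union> Y]\<^bsup>3\<^esup>; T \<inter> Y \<noteq> {}\<rbrakk> \<Longrightarrow> \<not> [T]\<^bsup>2\<^esup> \<subseteq> {e \<in> E. c e = Blue}"
      by (elim not_rich_witness) auto
    define IR IB where "IR = {e \<in> E. c e = Red} \<inter> [X \<union> Y]\<^bsup>2\<^esup>" and "IB = {e \<in> E. c e = Blue} \<inter> [X \<union> Y]\<^bsup>2\<^esup>"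
    have Z: "X \<union> Y \<subseteq> V" using XY by auto
    have "\<exists>T\<subseteq>IR. real (card T) \<le> t \<and> IR \<subseteq> T \<union> g (X \<union> Y) X T \<and>
        real (card (touching (X \<union> Y) X (g (X \<union> Y) X T))) \<le> real s ^ 3 / 11664"
      by (rule g[OF Z]) (use red in \<open>auto simp: IR_def\<close>)
    then obtain R where R: "R \<subseteq> IR" "real (card R) \<le> t" "IR \<subseteq> R \<union> g (X \<union> Y) X R"
        "real (card (touching (X \<union> Y) X (g (X \<union> Y) X R))) \<le> real s ^ 3 / 11664" by blast
    have "\<exists>T\<subseteq>IB. real (card T) \<le> t \<and> IB \<subseteq> T \<union> g (X \<union> Y) Y T \<and>
        real (card (touching (X \<union> Y) Y (g (X \<union> Y) Y T))) \<le> real s ^ 3 / 11664"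
      by (rule g[OF Z]) (use blue in \<open>auto simp: IB_def\<close>)
    then obtain B where B: "B \<subseteq> IB" "real (card B) \<le> t" "IB \<subseteq> B \<union> g (X \<union> Y) Y B"
        "real (card (touching (X \<union> Y) Y (g (X \<union> Y) Y B))) \<le> real s ^ 3 / 11664" by blast
    have ZM: "[X \<union> Y]\<^bsup>2\<^esup> \<subseteq> M" unfolding M_def by (rule nsets_mono[OF Z])
    have RM: "R \<subseteq> M" "B \<subseteq> M" using R(1) B(1) ZM by (auto simp: IR_def IB_def)
    have finRB: "finite R" "finite B" using RM finM finite_subset by blast+
    have finXY: "finite X" "finite Y" using XY finV finite_subset by blast+
    define U0 where "U0 = [X \<union> Y]\<^bsup>2\<^esup> - (g (X \<union> Y) X R \<union> g (X \<union> Y) Y B)"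
    have "\<gamma> * (real n)\<^sup>2 \<le> card U0"
      using uncovered_pairs[OF finXY XY(3,4,5) s R(4) B(4)] \<gamma> unfolding U0_def by linarith
    moreover have "card U0 - card (R \<union> B) \<le> card (U0 - (R \<union> B))"
      by (rule diff_card_le_card_Diff) (use finRB in simp)
    moreover have "card (R \<union> B) \<le> card R + card B" by (rule card_Un_le)
    \<comment> \<open>The fingerprints hold at most \<open>2 * t\<close> pairs, which is at most
      half of \<open>\<gamma> * n\<^sup>2\<close>.\<close>
    ultimately have "\<gamma> * (real n)\<^sup>2 / 2 \<le> card (U0 - (R \<union> B))"
      using R(2) B(2) t(2) by linarith
    moreover have "R \<inter> B = {}"
    proof -
      have "IR \<inter> IB = {}" by (auto simp: IR_def IB_def)
      then show ?thesis using R(1) B(1) by blast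
    qed
    ultimately have "(X,Y,R,B) \<in> Ix"
      using XY RM R(2) B(2) by (auto simp: Ix_def F_def U_def U0_def)
    moreover have "E \<in> Ev (X,Y,R,B)"
    proof -
      \<comment> \<open>An edge inside \<open>X \<union> Y\<close> is red or blue, hence in the
        fingerprint or in the container of its colour.\<close>
      have "e \<in> R \<union> B \<or> e \<notin> U0" if "e \<in> E" for e
      proof (cases "e \<in> [X \<union> Y]\<^bsup>2\<^esup>")
        case True
        then show ?thesis using that R(3) B(3) by (cases "c e") (auto simp: IR_def IB_def U0_def)
      qed (simp add: U0_def)
      then show ?thesis using R(1) B(1) by (auto simp: Ev_def U_def U0_def IR_def IB_def)
    qed
    ultimately show "E \<in> (\<Union>i\<in>Ix. Ev i)" by blast
  qed
  define w where "w = exp (- (p * (\<gamma> * (real n)\<^sup>2 / 2)))"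
  have Ev_le: "measure_pmf.prob (gnp n p) (Ev i) \<le> (case i of (X,Y,R,B) \<Rightarrow> p ^ card R * p ^ card B * w)"
    if "i \<in> Ix" for i
  proof -
    obtain X Y R B where i: "i = (X,Y,R,B)" by (metis prod_cases4)
    have *: "X \<subseteq> V" "Y \<subseteq> V" "R \<subseteq> M" "B \<subseteq> M" "R \<inter> B = {}" "\<gamma> * (real n)\<^sup>2 / 2 \<le> card (U X Y R B)"
      using that by (auto simp: i Ix_def F_def)
    have "finite R" "finite B" using * finM finite_subset by blast+
    \<comment> \<open>Disjointness of the two fingerprints lets their weights factor.\<close>
    then have cRB: "card (R \<union> B) = card R + card B" using *(5) by (simp add: card_Un_disjoint)
    have "[X \<union> Y]\<^bsup>2\<^esup> \<subseteq> M" unfolding M_def by (rule nsets_mono) (use * in auto)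
    then have UM: "U X Y R B \<subseteq> M" "(R \<union> B) \<inter> U X Y R B = {}" by (auto simp: U_def)
    have "measure_pmf.prob (gnp n p) (Ev i) = p ^ card (R \<union> B) * (1 - p) ^ card (U X Y R B)"
      unfolding i Ev_def prod.case
      by (rule gnp_prob_contains_avoids[OF p]) (use * UM in \<open>auto simp: M_def V_def\<close>)
    also have "(1 - p) ^ card (U X Y R B) \<le> exp (- p) ^ card (U X Y R B)"
      using p exp_ge_add_one_self[of "- p"] by (intro power_mono) auto
    also have "\<dots> = exp (- (p * card (U X Y R B)))" by (simp flip: exp_of_nat2_mult)
    also have "\<dots> \<le> w" unfolding w_def using mult_left_mono[OF *(6) p(1)] by simp
    finally show ?thesis using p by (simp add: i cRB power_add mult_left_mono)
  qed
  define S where "S = (\<Sum>T\<in>F. p ^ card T)"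
  have "measure_pmf.prob (gnp n p) {E. \<not> K3_rich {..<n} E s} \<le> measure_pmf.prob (gnp n p) (\<Union>i\<in>Ix. Ev i)"
    by (rule measure_pmf.finite_measure_mono[OF cover]) simp
  also have "\<dots> \<le> (\<Sum>i\<in>Ix. measure_pmf.prob (gnp n p) (Ev i))"
    by (rule measure_pmf.finite_measure_subadditive_finite[OF finIx]) simp
  also have "\<dots> \<le> (\<Sum>i\<in>Ix. case i of (X,Y,R,B) \<Rightarrow> p ^ card R * p ^ card B * w)"
    by (rule sum_mono) (rule Ev_le)
  \<comment> \<open>Extending to the full product drops the conditions linking \<open>R\<close> and
    \<open>B\<close>, so that the sum factors.\<close>
  also have "\<dots> \<le> (\<Sum>i\<in>Pow V \<times> Pow V \<times> F \<times> F. case i of (X,Y,R,B) \<Rightarrow> p ^ card R * p ^ card B * w)"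
    by (rule sum_mono2) (use finV finF p in \<open>auto simp: Ix_def w_def\<close>)
  also have "\<dots> = (\<Sum>X\<in>Pow V. \<Sum>Y\<in>Pow V. \<Sum>R\<in>F. \<Sum>B\<in>F. p ^ card R * p ^ card B * w)"
    by (simp only: sum.cartesian_product' prod.case)
  also have "(\<Sum>R\<in>F. \<Sum>B\<in>F. p ^ card R * p ^ card B * w) = S\<^sup>2 * w"
    unfolding S_def power2_eq_square sum_product by (simp only: sum_distrib_right)
  also have "(\<Sum>X\<in>Pow V. \<Sum>Y\<in>Pow V. S\<^sup>2 * w) = 2 ^ n * (2 ^ n * (S\<^sup>2 * w))"
    using finV by (simp add: card_Pow)
  also have "\<dots> = 4 ^ n * S\<^sup>2 * w"
  proof -
    have "(4 :: real) ^ n = 2 ^ n * 2 ^ n" by (simp flip: power_mult_distrib)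
    then show ?thesis by simp
  qed
  also have "S \<le> (1 / x) powr t * exp (p * x * (real n)\<^sup>2)"
  proof -
    have "S \<le> (1 / x) powr t * exp (p * x * card M)"
      unfolding S_def F_def by (rule sum_small_subsets_le[OF finM p(1) x])
    also have "\<dots> \<le> (1 / x) powr t * exp (p * x * (real n)\<^sup>2)"
    proof (rule mult_left_mono)
      have "p * x * card M \<le> p * x * (real n)\<^sup>2"
        by (rule mult_left_mono) (use card_nsets_2_le[of V n] finV p x in \<open>simp_all add: M_def\<close>)
      then show "exp (p * x * card M) \<le> exp (p * x * (real n)\<^sup>2)" by simp
    qed simp
    finally show ?thesis .
  qed
  then have "4 ^ n * S\<^sup>2 * w \<le> 4 ^ n * ((1 / x) powr t * exp (p * x * (real n)\<^sup>2))\<^sup>2 * w"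
  proof (intro mult_right_mono mult_left_mono power_mono)
    show "0 \<le> S" unfolding S_def using p by (intro sum_nonneg) simp
    show "0 \<le> w" by (simp add: w_def)
  qed simp_all
  finally show ?thesis by (simp add: w_def)
qed

text \<open>All exponents are compared with \<open>p * n\<^sup>2\<close>. The gain is a
  \<open>\<gamma> / 2\<close> share of it. With \<open>x = \<gamma> / 16\<close> the squared tilting
  factor costs a \<open>\<gamma> / 8\<close> share, and \<open>C\<close> is chosen so that the
  squared power of \<open>1 / x\<close> costs at most as much again. A \<open>\<gamma> / 4\<close>
  share remains, and \<open>1 \<le> C\<close> gives
  \<open>n powr (3/2) \<le> p * n\<^sup>2\<close>.\<close>

lemma not_rich_bound_le:
  fixes n :: nat and p x K C \<gamma> :: real
  assumes \<gamma>: "0 < \<gamma>" and x: "x = \<gamma> / 16" "x \<le> 1" and C: "C = 16 * K * ln (1 / x) / \<gamma> + 1"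
    and K: "0 < K" and n: "1 \<le> n" and p: "C * real n powr (-1/2) \<le> p"
  shows "4 ^ n * ((1 / x) powr (K * real n powr (3/2)) * exp (p * x * (real n)\<^sup>2))\<^sup>2 * exp (- (p * (\<gamma> * (real n)\<^sup>2 / 2)))
     \<le> 4 ^ n * exp (- (\<gamma> / 4 * real n powr (3/2)))"
proof -
  define N where "N = real n powr (3/2)"
  have N: "0 \<le> N" by (simp add: N_def)
  have x0: "0 < x" "0 \<le> ln (1 / x)" using \<gamma> x by (auto intro!: ln_ge_zero simp: field_simps)
  have C1: "1 \<le> C" using C K x0 \<gamma> by simp
  have "C * N = C * real n powr (-1/2) * (real n)\<^sup>2"
  proof -
    have "N = real n powr (-1/2 + 2)" by (simp add: N_def)
    also have "\<dots> = real n powr (-1/2) * (real n)\<^sup>2" using n by (subst powr_add) simp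
    finally show ?thesis by simp
  qed
  also have "\<dots> \<le> p * (real n)\<^sup>2" using p by (rule mult_right_mono) simp
  finally have pN: "C * N \<le> p * (real n)\<^sup>2" .
  have "2 * (ln (1 / x) * (K * N)) \<le> \<gamma> / 8 * (C * N)"
  proof -
    have "\<gamma> / 8 * C = 2 * K * ln (1 / x) + \<gamma> / 8" using C \<gamma> by (simp add: field_simps)
    then have "2 * K * ln (1 / x) * N \<le> (\<gamma> / 8 * C) * N" using \<gamma> N by (intro mult_right_mono) auto
    then show ?thesis by (simp add: mult_ac)
  qed
  also have "\<dots> \<le> \<gamma> / 8 * (p * (real n)\<^sup>2)" using pN \<gamma> by (intro mult_left_mono) auto
  finally have 1: "2 * (ln (1 / x) * (K * N)) \<le> \<gamma> / 8 * (p * (real n)\<^sup>2)" .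
  have 2: "2 * (p * x * (real n)\<^sup>2) = \<gamma> / 8 * (p * (real n)\<^sup>2)" by (simp add: x)
  have "1 * N \<le> C * N" using C1 N by (rule mult_right_mono)
  then have "\<gamma> / 4 * N \<le> \<gamma> / 4 * (p * (real n)\<^sup>2)" using pN \<gamma> by (intro mult_left_mono) auto
  moreover have "p * (\<gamma> * (real n)\<^sup>2 / 2) = \<gamma> / 2 * (p * (real n)\<^sup>2)" by simp
  ultimately have 3: "2 * (ln (1 / x) * (K * N)) + 2 * (p * x * (real n)\<^sup>2) - p * (\<gamma> * (real n)\<^sup>2 / 2) \<le> - (\<gamma> / 4 * N)"
    using 1 2 by linarith
  have "((1 / x) powr (K * N) * exp (p * x * (real n)\<^sup>2))\<^sup>2 * exp (- (p * (\<gamma> * (real n)\<^sup>2 / 2)))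
      = exp (2 * (ln (1 / x) * (K * N)) + 2 * (p * x * (real n)\<^sup>2) - p * (\<gamma> * (real n)\<^sup>2 / 2))"
    using x0(1) by (simp add: powr_def power2_eq_square mult_ac flip: exp_add)
  also have "\<dots> \<le> exp (- (\<gamma> / 4 * N))" using 3 by simp
  finally show ?thesis by (simp add: N_def mult.assoc)
qed

section \<open>Choice of constants and passage to the limit\<close>

theorem theorem2p4:
  fixes \<epsilon> :: real
  assumes "\<epsilon> > 0"
  shows "\<exists>C>0. \<forall>p :: nat \<Rightarrow> real.
           (\<forall>n. 0 \<le> p n \<and> p n \<le> 1) \<and>
           (\<forall>\<^sub>F n in sequentially. p n \<ge> C * real n powr (-1/2)) \<longrightarrow>
           (\<lambda>n. measure_pmf.prob (gnp n (p n))
                  {E. K3_rich {..<n} E (nat \<lfloor>\<epsilon> * real n\<rfloor>)}) \<longlonglongrightarrow> 1"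
proof -
  \<comment> \<open>Rounding down keeps \<open>\<epsilon> * n / 2 \<le> s n\<close> for large
    \<open>n\<close>; the factors 8 and 4 are the cube and the square of this 2, and 11664 and 1296
    come from \<open>uncovered_pairs\<close>. The minimum with 1 ensures
    \<open>x \<le> 1\<close>.\<close>
  define \<delta> where "\<delta> = \<epsilon> ^ 3 / (8 * 11664)"
  define \<gamma> where "\<gamma> = min 1 (\<epsilon>\<^sup>2 / (4 * 1296))"
  define x where "x = \<gamma> / 16"
  define K where "K = 12 * (8 / \<delta> + 1) / \<delta>"
  define C where "C = 16 * K * ln (1 / x) / \<gamma> + 1"
  have \<delta>: "0 < \<delta>" and \<gamma>: "0 < \<gamma>" "\<gamma> \<le> 1" using assms by (auto simp: \<delta>_def \<gamma>_def)
  have K: "0 < K" using \<delta> by (simp add: K_def add_pos_pos)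
  have x: "0 < x" "x \<le> 1" using \<gamma> by (auto simp: x_def)
  have C: "0 < C" using K x \<gamma> by (auto simp: C_def intro!: add_nonneg_pos divide_nonneg_pos mult_nonneg_nonneg ln_ge_zero)
  show ?thesis
  proof (intro exI[of _ C] conjI C allI impI)
    fix p :: "nat \<Rightarrow> real"
    assume p: "(\<forall>n. 0 \<le> p n \<and> p n \<le> 1) \<and> (\<forall>\<^sub>F n in sequentially. p n \<ge> C * real n powr (-1/2))"
    define s where "s n = nat \<lfloor>\<epsilon> * real n\<rfloor>" for n
    let ?P = "\<lambda>n. measure_pmf.prob (gnp n (p n)) {E. K3_rich {..<n} E (s n)}"
    define b where "b n = 4 ^ n * exp (- (\<gamma> / 4 * real n powr (3/2)))" for n
    have n_top: "filterlim (\<lambda>n. \<epsilon> * real n) at_top sequentially"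
      by (rule filterlim_tendsto_pos_mult_at_top[OF tendsto_const assms filterlim_real_sequentially])
    have sqrt_top: "filterlim (\<lambda>n. sqrt (real n)) at_top sequentially"
      by (rule filterlim_compose[OF sqrt_at_top filterlim_real_sequentially])
    \<comment> \<open>The bound 164 gives \<open>162 \<le> s n\<close> and
      \<open>\<epsilon> * n / 2 \<le> s n\<close> after rounding down.\<close>
    have ev1: "\<forall>\<^sub>F n in sequentially. 164 \<le> \<epsilon> * real n"
      using n_top by (simp add: filterlim_at_top)
    \<comment> \<open>The first makes four times the fingerprint bound at most
      \<open>\<gamma> * n\<^sup>2\<close>; the second lets
      \<open>exp (- (\<gamma> / 4 * n powr (3/2)))\<close> absorb \<open>4 ^ n\<close> and still
      leave \<open>exp (- n)\<close>.\<close>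
    have ev2: "\<forall>\<^sub>F n in sequentially. 4 * K / \<gamma> \<le> sqrt (real n)"
      and ev3: "\<forall>\<^sub>F n in sequentially. 4 * (ln 4 + 1) / \<gamma> \<le> sqrt (real n)"
      using sqrt_top by (simp_all add: filterlim_at_top)
    have lower: "\<forall>\<^sub>F n in sequentially. 1 - exp (- real n) \<le> ?P n"
      using ev1 ev2 conjunct2[OF p] eventually_ge_at_top[of 1] ev3
    proof eventually_elim
      case (elim n)
      have pow: "real n powr (3/2) = real n * sqrt (real n)"
        using elim(4) powr_add[of "real n" 1 "1/2"] by (simp add: powr_half_sqrt)
      have "real n * sqrt (real n) * (4 * K) \<le> real n * sqrt (real n) * (\<gamma> * sqrt (real n))"
        using elim(2) \<gamma>(1) by (intro mult_left_mono) (auto simp: field_simps)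
      also have "\<dots> = \<gamma> * (real n)\<^sup>2" by (simp add: power2_eq_square)
      finally have t: "4 * (K * real n powr (3/2)) \<le> \<gamma> * (real n)\<^sup>2" by (simp add: pow mult_ac)
      have "real n * (ln 4 + 1) \<le> real n * (\<gamma> / 4 * sqrt (real n))"
        using elim(5) \<gamma>(1) by (intro mult_left_mono) (auto simp: field_simps)
      then have "real n * ln 4 - \<gamma> / 4 * real n powr (3/2) \<le> - real n"
        by (simp add: pow algebra_simps)
      then have "exp (real n * ln 4) * exp (- (\<gamma> / 4 * real n powr (3/2))) \<le> exp (- real n)"
        by (simp flip: exp_add)
      then have b: "b n \<le> exp (- real n)" by (simp add: b_def exp_of_nat_mult)
      have sn: "\<epsilon> * real n / 2 \<le> real (s n)" "162 \<le> s n" using elim(1) unfolding s_def by linarith+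
      have cube: "\<delta> * real n ^ 3 \<le> real (s n) ^ 3 / 11664"
        using power_mono[OF sn(1), of 3] assms by (simp add: \<delta>_def power_mult_distrib power_divide)
      have "\<gamma> * (real n)\<^sup>2 \<le> \<epsilon>\<^sup>2 / (4 * 1296) * (real n)\<^sup>2" by (intro mult_right_mono) (auto simp: \<gamma>_def)
      also have "\<dots> \<le> real (s n) ^ 2 / 1296"
        using power_mono[OF sn(1), of 2] assms by (simp add: power_mult_distrib power_divide)
      finally have square: "\<gamma> * (real n)\<^sup>2 \<le> (real (s n))\<^sup>2 / 1296" .
      have "measure_pmf.prob (gnp n (p n)) {E. \<not> K3_rich {..<n} E (s n)} \<le> b n"
        unfolding b_def
        by (rule order_trans[OF gnp_not_rich_le[OF elim(4) sn(2) \<delta> cube square _ t _ _ x]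
                not_rich_bound_le[OF \<gamma>(1) x_def x(2) C_def K elim(4,3)]])
          (use p in \<open>auto simp: K_def\<close>)
      moreover have "measure_pmf.prob (gnp n (p n)) {E. \<not> K3_rich {..<n} E (s n)} = 1 - ?P n"
        using measure_pmf.prob_compl[of "{E. K3_rich {..<n} E (s n)}" "gnp n (p n)"]
        by (simp add: set_diff_eq)
      ultimately show ?case using b by linarith
    qed
    have "(\<lambda>n. exp (- real n)) \<longlonglongrightarrow> 0"
      by (rule filterlim_compose[OF exp_at_bot])
        (simp add: filterlim_uminus_at_bot filterlim_real_sequentially)
    then have "(\<lambda>n. 1 - exp (- real n)) \<longlonglongrightarrow> 1 - 0" by (intro tendsto_intros)
    then have "?P \<longlonglongrightarrow> 1"
      by (intro tendsto_sandwich[OF lower _ _ tendsto_const]) auto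
    then show "(\<lambda>n. measure_pmf.prob (gnp n (p n)) {E. K3_rich {..<n} E (nat \<lfloor>\<epsilon> * real n\<rfloor>)}) \<longlonglongrightarrow> 1"
      by (simp add: s_def)
  qed
qed

end
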